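(* For all $n \in \mathbb{N}$, $$\sum_{\delta\in\mathcal{D}_{2n}} H[\delta;q] = q^n R_{\mathcal{I}^{FPF}_{2n}}(q) = q^n\prod_{k=1}^n [2k-1]_q,$$ where $\mathcal{D}_{2n}$ is the set of Dyck paths of length $2n$, $H[\delta;q]$ is the generating function over labelings of $\delta$ defined in the context, and $R_{\mathcal{I}^{FPF}_{2n}}(q)$ is the rank generating function of Bruhat order restricted to the fixed-point-free involutions in $\mathfrak{S}_{2n}$.
   Context: Permutations and Bruhat order. $\mathfrak{S}_m$ is the set of permutations of $[m]=\{1,\dots,m\}$. For $\pi\in\mathfrak{S}_m$, $\ell(\pi)=|\{(i,j)\in[m]^2 : i<j,\ \pi(i)>\pi(j)\}|$. Bruhat order $(\mathfrak{S}_m,\le)$ is the partial order that is the transitive closure of the relations $\pi\lessdot(i\;j)\pi$ whenever $(i\;j)$ is a transposition with $\ell((i\;j)\pi)=\ell(\pi)+1$. $\mathcal{I}^{FPF}_{2n}=\{\tau\in\mathfrak{S}_{2n} : \tau^2=\mathrm{id},\ \tau(i)\neq i \text{ for all } i\in[2n]\}$ is the set of fixed-point-free involutions, with the induced partial order. For $\tau\in\mathcal{I}^{FPF}_{2n}$ let $\hat\ell^{FPF}(\tau)=\frac{\ell(\tau)-n}{2}$. It is known that $(\mathcal{I}^{FPF}_{2n},\le)$ is a graded poset with rank function $\hat\ell^{FPF}$. For a graded poset $P$ with rank function $r$, the rank generating function is $R_P(q)=\sum_{p\in P}q^{r(p)}$; thus $R_{\mathcal{I}^{FPF}_{2n}}(q)=\sum_{\tau\in\mathcal{I}^{FPF}_{2n}}q^{\hat\ell^{FPF}(\tau)}$.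 Also $[m]_q=\frac{1-q^m}{1-q}$ for $m\ge1$. Dyck paths. A Dyck path of length $2n$ is a lattice path $\delta=\delta_1\cdots\delta_{2n}$ from $(0,0)$ to $(2n,0)$ consisting of up steps $U=(1,1)$ and down steps $D=(1,-1)$ that does not go below the $x$-axis. The height $h_i(\delta)$ of the $i$th step is the larger of the $y$-coordinates of its two endpoints. A labeling $\lambda$ of $\delta$ assigns to each $i$ with $\delta_i=D$ an integer $\lambda_i\in\{1,\dots,h_i(\delta)\}$. Define $$H_i(\delta,\lambda)=\begin{cases}\lambda_i-1 & \delta_i=D\\ h_i(\delta) & \delta_i=U\end{cases},\qquad H(\delta,\lambda)=\sum_{i=1}^{2n}H_i(\delta,\lambda),\qquad H[\delta;q]=\sum_\lambda q^{H(\delta,\lambda)},$$ where the last sum is over all labelings $\lambda$ of $\delta$. *)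

theory Defs
  imports
    "HOL-Combinatorics.Combinatorics"
    "HOL-Computational_Algebra.Computational_Algebra"
begin

text \<open>Generating functions are formal: they are polynomials in \<open>qvar\<close> with integer coefficients.\<close>

abbreviation qvar :: "int poly" where
  "qvar \<equiv> [:0, 1:]"

text \<open>The division below is the exact division of \<^typ>\<open>int poly\<close>; the lemma after it shows that
  there is no remainder.\<close>

definition q_bracket :: "nat \<Rightarrow> int poly" where
  "q_bracket m = (1 - qvar ^ m) div (1 - qvar)"

lemma q_bracket_times: "(1 - qvar) * q_bracket m = 1 - qvar ^ m"
proof -
  have "1 - qvar ^ m = (1 - qvar) * (\<Sum>i<m. qvar ^ i)"
    by (rule one_diff_power_eq)
  then have "(1 - qvar) dvd (1 - qvar ^ m)"
    by (rule dvdI)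
  then show ?thesis
    by (simp add: q_bracket_def)
qed


subsection \<open>Graded posets\<close>

definition poset_covers :: "'a set \<Rightarrow> ('a \<Rightarrow> 'a \<Rightarrow> bool) \<Rightarrow> 'a \<Rightarrow> 'a \<Rightarrow> bool" where
  "poset_covers P le x y \<longleftrightarrow>
     x \<in> P \<and> y \<in> P \<and> le x y \<and> x \<noteq> y \<and>
     \<not> (\<exists>z\<in>P. z \<noteq> x \<and> z \<noteq> y \<and> le x z \<and> le z y)"

definition is_rank_function :: "'a set \<Rightarrow> ('a \<Rightarrow> 'a \<Rightarrow> bool) \<Rightarrow> ('a \<Rightarrow> nat) \<Rightarrow> bool" where
  "is_rank_function P le r \<longleftrightarrow>
     (\<forall>x\<in>P. (\<forall>y\<in>P. le y x \<longrightarrow> y = x) \<longrightarrow> r x = 0) \<and>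
     (\<forall>x y. poset_covers P le x y \<longrightarrow> r y = r x + 1)"

text \<open>On a finite graded poset \<open>P\<close> a rank function exists and its values on \<open>P\<close> are unique, so the
  choice made here is immaterial: it only concerns the values outside \<open>P\<close>.\<close>

definition poset_rank :: "'a set \<Rightarrow> ('a \<Rightarrow> 'a \<Rightarrow> bool) \<Rightarrow> 'a \<Rightarrow> nat" where
  "poset_rank P le = (SOME r. is_rank_function P le r)"

definition rank_gen_fun :: "'a set \<Rightarrow> ('a \<Rightarrow> 'a \<Rightarrow> bool) \<Rightarrow> int poly" where
  "rank_gen_fun P le = (\<Sum>p\<in>P. qvar ^ poset_rank P le p)"


subsection \<open>Permutations and Bruhat order\<close>

text \<open>A permutation of \<open>{1..m}\<close> is a function on \<open>nat\<close> that is the identity outside \<open>{1..m}\<close>.\<close>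

definition perm_length :: "nat \<Rightarrow> (nat \<Rightarrow> nat) \<Rightarrow> nat" where
  "perm_length m p = card {(i, j). i \<in> {1..m} \<and> j \<in> {1..m} \<and> i < j \<and> p i > p j}"

definition bruhat_step :: "nat \<Rightarrow> (nat \<Rightarrow> nat) \<Rightarrow> (nat \<Rightarrow> nat) \<Rightarrow> bool" where
  "bruhat_step m p r \<longleftrightarrow>
     p permutes {1..m} \<and>
     (\<exists>i\<in>{1..m}. \<exists>j\<in>{1..m}. i \<noteq> j \<and> r = transpose i j \<circ> p \<and>
        perm_length m r = perm_length m p + 1)"

definition bruhat_le :: "nat \<Rightarrow> (nat \<Rightarrow> nat) \<Rightarrow> (nat \<Rightarrow> nat) \<Rightarrow> bool" where
  "bruhat_le m p r \<longleftrightarrow> p permutes {1..m} \<and> rtranclp (bruhat_step m) p r"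

definition fpf_involutions :: "nat \<Rightarrow> (nat \<Rightarrow> nat) set" where
  "fpf_involutions m = {t. t permutes {1..m} \<and> t \<circ> t = id \<and> (\<forall>i\<in>{1..m}. t i \<noteq> i)}"

lemma finite_fpf_involutions: "finite (fpf_involutions m)"
  by (rule finite_subset[of _ "{t. t permutes {1..m}}"])
    (auto simp: fpf_involutions_def finite_permutations)


subsection \<open>Labeled Dyck paths\<close>

datatype step = Up | Down

primrec step_rise :: "step \<Rightarrow> int" where
  "step_rise Up = 1"
| "step_rise Down = -1"

text \<open>The \<open>y\<close>-coordinate after the first \<open>i\<close> steps. Positions in a path count from 0, so the step
  \<open>d ! i\<close> goes from level \<open>i\<close> to level \<open>i + 1\<close>.\<close>

definition level :: "step list \<Rightarrow> nat \<Rightarrow> int" where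
  "level d i = (\<Sum>s\<leftarrow>take i d. step_rise s)"

definition dyck_paths :: "nat \<Rightarrow> step list set" where
  "dyck_paths m = {d. length d = m \<and> (\<forall>i\<le>m. level d i \<ge> 0) \<and> level d m = 0}"

lemma finite_dyck_paths: "finite (dyck_paths m)"
proof (rule finite_subset)
  show "dyck_paths m \<subseteq> {d. set d \<subseteq> {Up, Down} \<and> length d = m}"
    using step.exhaust by (auto simp: dyck_paths_def)
  show "finite {d. set d \<subseteq> {Up, Down} \<and> length d = m}"
    by (rule finite_lists_length_eq) simp
qed

definition step_height :: "step list \<Rightarrow> nat \<Rightarrow> nat" where
  "step_height d i = nat (max (level d i) (level d (i + 1)))"

definition labelings :: "step list \<Rightarrow> (nat \<Rightarrow> nat) set" where
  "labelings d = (\<Pi>\<^sub>E i\<in>{i. i < length d \<and> d ! i = Down}. {1..step_height d i})"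

lemma finite_labelings: "finite (labelings d)"
  unfolding labelings_def by (rule finite_PiE) auto

definition step_weight :: "step list \<Rightarrow> (nat \<Rightarrow> nat) \<Rightarrow> nat \<Rightarrow> nat" where
  "step_weight d lab i = (case d ! i of Down \<Rightarrow> lab i - 1 | Up \<Rightarrow> step_height d i)"

definition path_weight :: "step list \<Rightarrow> (nat \<Rightarrow> nat) \<Rightarrow> nat" where
  "path_weight d lab = (\<Sum>i<length d. step_weight d lab i)"

definition path_gen_fun :: "step list \<Rightarrow> int poly" where
  "path_gen_fun d = (\<Sum>lab\<in>labelings d. qvar ^ path_weight d lab)"

end

theory Submission
  imports Defs
begin

text \<open>
  If \<open>\<tau>(k) < \<tau>(k+1)\<close> for a fixed-point-free involution \<open>\<tau>\<close>, then conjugating it by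
  \<open>s = (k k+1)\<close> raises its length by 2. Conversely every \<open>\<tau>\<close> of length more than
  \<open>n\<close> can be lowered in this way, so \<open>(\<ell> - n)/2\<close> is a natural number. That it is the rank function follows from an
  interpolation property: for \<open>x < y\<close> there is \<open>z\<close> with \<open>x < z \<le> y\<close> and \<open>\<ell>(z) = \<ell>(x) + 2\<close>. It is proved by
  induction on \<open>\<ell>(y)\<close>, lowering \<open>y\<close> to \<open>sys\<close> and lifting or lowering \<open>x\<close> alongside. The delicate
  case is \<open>sxs = x\<close>, where the lifting property of Bruhat order only yields \<open>sx \<le> sys\<close>. There the
  dominance criterion (comparison of the numbers of \<open>c \<le> i\<close> with \<open>p(c) \<le> j\<close>) gives \<open>x \<le> sys\<close>: the
  counts of \<open>x\<close> and \<open>sx\<close> differ only at \<open>(k, k)\<close>, by 1, and there a fixed-point-free involution has a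
  count of fixed parity.

  Sorting by \<open>a = \<tau>(2n)\<close>, the conjugations move the class \<open>a + 1\<close> to the class \<open>a\<close>, and the class
  \<open>a = 2n - 1\<close> is the case \<open>n - 1\<close>; so each step contributes the factor \<open>[2n-1]\<close>.

  For Dyck paths let \<open>F(m, h)\<close> be the weighted sum over paths of length \<open>m\<close> from height \<open>h\<close> down to 0.
  The first-step recursion \<open>F(m+1, h) = q^(h+1) F(m, h+1) + [h] F(m, h-1)\<close> is solved by
  \<open>F(h+2k, h) = q^k [h+2k]! / ([2][4]...[2k])\<close>, because \<open>[h+2k] = [h] + q^h [2k]\<close>.
\<close>

subsection \<open>Adjacent transpositions and length\<close>

abbreviation adj_swap :: "nat \<Rightarrow> nat \<Rightarrow> nat" where
  "adj_swap k \<equiv> transpose k (Suc k)"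

lemma adj_swap_permutes: "1 \<le> k \<Longrightarrow> k < m \<Longrightarrow> adj_swap k permutes {1..m}"
  by (rule permutes_swap_id) auto

lemma adj_swap_comp_permutes:
  "p permutes {1..m} \<Longrightarrow> 1 \<le> k \<Longrightarrow> k < m \<Longrightarrow> (adj_swap k \<circ> p) permutes {1..m}"
  by (rule permutes_compose[OF _ adj_swap_permutes])

lemma adj_swap_less_iff:
  "a \<noteq> b \<Longrightarrow> adj_swap k a < adj_swap k b \<longleftrightarrow>
     (if a = k \<and> b = Suc k then False else if a = Suc k \<and> b = k then True else a < b)"
  by (auto simp: transpose_def)

lemma inv_adj_swap_comp:
  assumes "p permutes A"
  shows "inv (adj_swap k \<circ> p) = inv p \<circ> adj_swap k"
  using assms by (metis bij_swap_iff bij_id inv_swap_id o_inv_distrib permutes_bij bij_transpose inv_transpose_eq)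

lemma inj_transpose_apply: "inj f \<Longrightarrow> f (transpose a b x) = transpose (f a) (f b) (f x)"
  by (simp add: transpose_def inj_eq)

lemma adj_swap_comp_idem: "adj_swap k \<circ> (adj_swap k \<circ> p) = p"
  by (simp add: fun_eq_iff)

lemma finite_inversions: "finite {(i, j). i \<in> {1..m::nat} \<and> j \<in> {1..m} \<and> i < j \<and> p i > (p j :: nat)}"
  by (rule finite_subset[of _ "{1..m} \<times> {1..m}"]) auto

text \<open>Left multiplication exchanges the values \<open>k\<close> and \<open>Suc k\<close>, so
  the positions of these two values form the only pair whose comparison changes; here it becomes an
  inversion.\<close>

lemma perm_length_adj_swap:
  assumes p: "p permutes {1..m}" and k: "1 \<le> k" "k < m" and asc: "inv p k < inv p (Suc k)"
  shows "perm_length m (adj_swap k \<circ> p) = perm_length m p + 1"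
proof -
  let ?I = "\<lambda>p. {(i, j). i \<in> {1..m} \<and> j \<in> {1..m} \<and> i < j \<and> p i > (p j::nat)}"
  have inj: "p i = p j \<longleftrightarrow> i = j" for i j
    using permutes_inj[OF p] by (auto simp: inj_def)
  have inv_iff: "i = inv p v \<longleftrightarrow> p i = v" for v i
    using permutes_inv_eq[OF p, of v i] by metis
  have vals: "p (inv p v) = v" for v
    using permutes_inverses[OF p] by auto
  have rng: "inv p k \<in> {1..m}" "inv p (Suc k) \<in> {1..m}"
    using permutes_in_image[OF permutes_inv[OF p]] k by (metis atLeastAtMost_iff le_SucI less_imp_le Suc_leI)+
  have "(i, j) \<in> ?I (adj_swap k \<circ> p) \<longleftrightarrow> (i, j) \<in> insert (inv p k, inv p (Suc k)) (?I p)" for i j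
  proof (cases "i < j")
    case True
    then have ne: "p j \<noteq> p i" using inj by auto
    have *: "\<not> (p j = k \<and> p i = Suc k)"
      using asc True inv_iff by (metis less_asym)
    have **: "(i, j) = (inv p k, inv p (Suc k)) \<longleftrightarrow> p i = k \<and> p j = Suc k"
      using inv_iff by auto
    show ?thesis
      using True * rng ** adj_swap_less_iff[OF ne, of k] by auto
  next
    case False
    then show ?thesis using asc by auto
  qed
  then have "?I (adj_swap k \<circ> p) = insert (inv p k, inv p (Suc k)) (?I p)"
    by (simp add: set_eq_iff)
  moreover have "(inv p k, inv p (Suc k)) \<notin> ?I p"
    by (simp add: vals)
  ultimately show ?thesis
    unfolding perm_length_def using finite_inversions[of m p] by simp
qed

lemma perm_length_adj_swap_descent:
  assumes p: "p permutes {1..m}" and k: "1 \<le> k" "k < m" and desc: "inv p (Suc k) < inv p k"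
  shows "perm_length m p = perm_length m (adj_swap k \<circ> p) + 1"
  using perm_length_adj_swap[OF adj_swap_comp_permutes[OF p k] k] desc
  by (simp add: inv_adj_swap_comp[OF p] adj_swap_comp_idem)

text \<open>The map from (i, j) to (p j, p i) is a bijection from the inversions of \<open>p\<close>
  to those of its inverse.\<close>

lemma perm_length_inv:
  assumes p: "p permutes {1..m}"
  shows "perm_length m (inv p) = perm_length m p"
  unfolding perm_length_def
proof (rule bij_betw_same_card[symmetric], rule bij_betwI')
  let ?f = "\<lambda>(i, j). (p j, p i)"
  let ?I = "\<lambda>p. {(i, j). i \<in> {1..m} \<and> j \<in> {1..m} \<and> i < j \<and> p i > (p j::nat)}"
  show "(?f x = ?f y) = (x = y)" for x y
    using permutes_inj[OF p] by (auto simp: inj_def split: prod.splits)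
  show "?f x \<in> ?I (inv p)" if "x \<in> ?I p" for x
    using that permutes_in_image[OF p] permutes_inverses[OF p] by auto
  show "\<exists>x\<in>?I p. y = ?f x" if y: "y \<in> ?I (inv p)" for y
  proof -
    obtain i j where ij: "y = (i, j)" "i \<in> {1..m}" "j \<in> {1..m}" "i < j" "inv p j < inv p i"
      using y by blast
    have "inv p i \<in> {1..m}" "inv p j \<in> {1..m}"
      using permutes_in_image[OF permutes_inv[OF p]] ij(2,3) by blast+
    with ij show ?thesis
      by (intro bexI[of _ "(inv p j, inv p i)"]) (simp_all add: permutes_inverses[OF p])
  qed
qed

text \<open>Induction on \<open>b\<close> via (a c+1) = s (a c) s with s = (c c+1). The middle
  factor raises the length by the induction hypothesis. The outer factors change it by 1 each, and
  they cannot both lower it.\<close>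

lemma perm_length_transpose_less:
  assumes "p permutes {1..m}" "1 \<le> a" "Suc a \<le> b" "b \<le> m" "inv p a < inv p b"
  shows "perm_length m p < perm_length m (transpose a b \<circ> p)"
  using assms(3,1,2,4-)
proof (induction b arbitrary: p rule: dec_induct)
  case base
  then show ?case using perm_length_adj_swap[of p m a] by linarith
next
  case (step c)
  let ?s = "adj_swap c"
  let ?q = "?s \<circ> p"
  let ?r = "transpose a c \<circ> ?q"
  have c: "1 \<le> c" "c < m" "a < c" using step.prems step.hyps by auto
  have q: "?q permutes {1..m}"
    by (rule adj_swap_comp_permutes[OF step.prems(1) c(1,2)])
  have iq: "inv ?q = inv p \<circ> ?s" by (rule inv_adj_swap_comp[OF step.prems(1)])
  have t: "transpose a c permutes {1..m}"
    by (rule permutes_swap_id) (use step.prems c in auto)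
  have r: "?r permutes {1..m}"
    by (rule permutes_compose[OF q t])
  have ir: "inv ?r = inv p \<circ> ?s \<circ> transpose a c"
    using iq q by (metis bij_transpose inv_transpose_eq o_inv_distrib permutes_bij)
  have eq: "transpose a (Suc c) \<circ> p = ?s \<circ> ?r"
    using c by (auto simp: fun_eq_iff transpose_def)
  have "perm_length m ?q < perm_length m ?r"
  proof (rule step.IH[OF q])
    show "inv ?q a < inv ?q c" unfolding iq using step.prems c by simp
  qed (use step.prems c in auto)
  have inj: "inv p i = inv p j \<longleftrightarrow> i = j" for i j
    using permutes_inj[OF permutes_inv[OF step.prems(1)]] by (auto simp: inj_def)
  consider "inv p c < inv p (Suc c)" | "inv p (Suc c) < inv p c"
    using inj by (metis n_not_Suc_n nat_neq_iff)
  then show ?case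
  proof cases
    case 1
    then have "perm_length m ?q = perm_length m p + 1"
      by (rule perm_length_adj_swap[OF step.prems(1) c(1,2)])
    moreover have "perm_length m ?r \<le> perm_length m (?s \<circ> ?r) + 1"
    proof (cases "inv ?r c < inv ?r (Suc c)")
      case True
      then show ?thesis using perm_length_adj_swap[OF r c(1,2)] by simp
    next
      case False
      then have "inv ?r (Suc c) < inv ?r c"
        using permutes_inj[OF permutes_inv[OF r]] by (metis inj_def n_not_Suc_n nat_neq_iff)
      then show ?thesis using perm_length_adj_swap_descent[OF r c(1,2)] by simp
    qed
    ultimately show ?thesis
      unfolding eq using \<open>perm_length m ?q < perm_length m ?r\<close> by linarith
  next
    case 2
    then have "perm_length m p = perm_length m ?q + 1"
      by (rule perm_length_adj_swap_descent[OF step.prems(1) c(1,2)])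
    \<comment> \<open>The two sides are the positions of \<open>a\<close> and \<open>c\<close> in
      \<open>p\<close>, and the position of \<open>Suc c\<close> lies between them.\<close>
    moreover have "inv ?r c < inv ?r (Suc c)"
      using 2 step.prems c by (auto simp: ir transpose_def)
    then have "perm_length m (?s \<circ> ?r) = perm_length m ?r + 1"
      by (rule perm_length_adj_swap[OF r c(1,2)])
    ultimately show ?thesis
      unfolding eq using \<open>perm_length m ?q < perm_length m ?r\<close> by linarith
  qed
qed

text \<open>Otherwise the values are in increasing order of position after the transposition, and
  transposing them back would raise the length as well.\<close>

lemma inv_less_if_perm_length_transpose_less:
  assumes p: "p permutes {1..m}" and ab: "1 \<le> a" "a < b" "b \<le> m"
    and len: "perm_length m p < perm_length m (transpose a b \<circ> p)"
  shows "inv p a < inv p b"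
proof (rule ccontr)
  let ?q = "transpose a b \<circ> p"
  have q: "?q permutes {1..m}"
    by (rule permutes_compose[OF p permutes_swap_id]) (use ab in auto)
  have iq: "inv ?q = inv p \<circ> transpose a b"
    using p by (metis bij_transpose inv_transpose_eq o_inv_distrib permutes_bij)
  assume "\<not> inv p a < inv p b"
  moreover have "inv p a \<noteq> inv p b"
    using permutes_inj[OF permutes_inv[OF p]] ab by (auto simp: inj_def)
  ultimately have "inv ?q a < inv ?q b" by (simp add: iq)
  from perm_length_transpose_less[OF q ab(1) _ ab(3) this]
  have "perm_length m ?q < perm_length m p" using ab by (simp flip: comp_assoc)
  with len show False by simp
qed

subsection \<open>Bruhat order and its dominance criterion\<close>

lemma bruhat_step_permutes: "bruhat_step m p r \<Longrightarrow> p permutes {1..m} \<and> r permutes {1..m}"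
  unfolding bruhat_step_def by (auto intro!: permutes_compose permutes_swap_id)

lemma bruhat_step_length: "bruhat_step m p r \<Longrightarrow> perm_length m r = perm_length m p + 1"
  by (auto simp: bruhat_step_def)

lemma bruhat_step_adj_swap:
  assumes "p permutes {1..m}" "1 \<le> k" "k < m" "inv p k < inv p (Suc k)"
  shows "bruhat_step m p (adj_swap k \<circ> p)"
proof -
  have "k \<in> {1..m}" "Suc k \<in> {1..m}" "k \<noteq> Suc k"
    using assms(2,3) by auto
  then show ?thesis
    unfolding bruhat_step_def using assms(1) perm_length_adj_swap[OF assms] by blast
qed

text \<open>Orders the two transposed values and trades the length condition for a comparison of
  their positions, the form in which steps are analysed below.\<close>

lemma bruhat_stepE:
  assumes "bruhat_step m p r"
  obtains a b where "1 \<le> a" "a < b" "b \<le> m" "r = transpose a b \<circ> p" "inv p a < inv p b"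
proof -
  obtain i j where ij: "i \<in> {1..m}" "j \<in> {1..m}" "i \<noteq> j" "r = transpose i j \<circ> p"
    and p: "p permutes {1..m}" and len: "perm_length m r = perm_length m p + 1"
    using assms unfolding bruhat_step_def by auto
  show thesis
  proof (cases "i < j")
    case True
    show thesis
      by (rule that[of i j])
        (use ij True inv_less_if_perm_length_transpose_less[OF p _ True] len in auto)
  next
    case False
    then have ji: "j < i" using ij by auto
    show thesis
      by (rule that[of j i])
        (use ij ji inv_less_if_perm_length_transpose_less[OF p _ ji] len
          in \<open>auto simp: transpose_commute\<close>)
  qed
qed

text \<open>A transposition moves past the inverse of \<open>p\<close> by relabelling its two
  points. Invariance under inversion turns every result on left multiplication into one on right
  multiplication.\<close>

lemma bruhat_step_inv:
  assumes "bruhat_step m p r"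
  shows "bruhat_step m (inv p) (inv r)"
proof -
  obtain i j where ij: "i \<in> {1..m}" "j \<in> {1..m}" "i \<noteq> j" "r = transpose i j \<circ> p"
    and p: "p permutes {1..m}" and len: "perm_length m r = perm_length m p + 1"
    using assms unfolding bruhat_step_def by auto
  have r: "r permutes {1..m}" using bruhat_step_permutes[OF assms] by simp
  have "inv r = inv p \<circ> transpose i j"
    using p ij(4) by (metis bij_transpose inv_transpose_eq o_inv_distrib permutes_bij)
  also have "\<dots> = transpose (inv p i) (inv p j) \<circ> inv p"
    by (rule ext) (simp only: comp_apply inj_transpose_apply[OF permutes_inj[OF permutes_inv[OF p]]])
  finally have "inv r = transpose (inv p i) (inv p j) \<circ> inv p" .
  moreover have "inv p i \<in> {1..m}" "inv p j \<in> {1..m}"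
    using ij(1,2) permutes_in_image[OF permutes_inv[OF p]] by blast+
  moreover have "inv p i \<noteq> inv p j"
    using ij(3) inj_eq[OF permutes_inj[OF permutes_inv[OF p]]] by blast
  ultimately show ?thesis
    unfolding bruhat_step_def using p r len permutes_inv[OF p]
    by (metis perm_length_inv)
qed

lemma bruhat_le_refl: "p permutes {1..m} \<Longrightarrow> bruhat_le m p p"
  by (simp add: bruhat_le_def)

lemma bruhat_le_trans: "bruhat_le m p q \<Longrightarrow> bruhat_le m q r \<Longrightarrow> bruhat_le m p r"
  by (auto simp: bruhat_le_def)

lemma bruhat_le_step: "bruhat_step m p r \<Longrightarrow> bruhat_le m p r"
  using bruhat_step_permutes by (auto simp: bruhat_le_def)

lemma bruhat_le_induct [consumes 1, case_names refl step]:
  assumes "bruhat_le m p r"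
    and "p permutes {1..m} \<Longrightarrow> P p"
    and "\<And>q r. bruhat_le m p q \<Longrightarrow> bruhat_step m q r \<Longrightarrow> P q \<Longrightarrow> P r"
  shows "P r"
proof -
  have p: "p permutes {1..m}" and "rtranclp (bruhat_step m) p r"
    using assms(1) by (auto simp: bruhat_le_def)
  from this(2) show ?thesis
    by (induction rule: rtranclp_induct) (use assms(2,3) p in \<open>auto simp: bruhat_le_def\<close>)
qed

lemma bruhat_le_inv: "bruhat_le m p r \<Longrightarrow> bruhat_le m (inv p) (inv r)"
proof (induction rule: bruhat_le_induct)
  case refl
  then show ?case by (simp add: bruhat_le_refl permutes_inv)
next
  case (step q r)
  then show ?case using bruhat_le_trans bruhat_le_step bruhat_step_inv by blast
qed

lemma bruhat_le_length: "bruhat_le m p r \<Longrightarrow> p = r \<or> perm_length m p < perm_length m r"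
  by (induction rule: bruhat_le_induct) (auto simp: bruhat_step_def)

text \<open>If w = (a b) v with (a b) different from s, then s keeps \<open>a\<close> and
  \<open>b\<close> in order, so s w = (s a, s b) s v is longer than s v. But s v has length l(v) + 1
  and s w only l(w) - 1 = l(v).\<close>

lemma bruhat_step_exchange:
  assumes vw: "bruhat_step m v w" and k: "1 \<le> k" "k < m"
    and asc: "inv v k < inv v (Suc k)" and desc: "inv w (Suc k) < inv w k"
  shows "w = adj_swap k \<circ> v"
proof (rule ccontr)
  let ?s = "adj_swap k"
  assume neq: "w \<noteq> ?s \<circ> v"
  obtain a b where ab: "1 \<le> a" "a < b" "b \<le> m" "w = transpose a b \<circ> v" "inv v a < inv v b"
    using vw by (rule bruhat_stepE)
  have v: "v permutes {1..m}" and w: "w permutes {1..m}"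
    using bruhat_step_permutes[OF vw] by auto
  have "\<not> (a = k \<and> b = Suc k)" using neq ab(4) by auto
  then have less: "?s a < ?s b" using ab(2) adj_swap_less_iff[of a b k] by auto
  have conj: "?s \<circ> w = transpose (?s a) (?s b) \<circ> (?s \<circ> v)"
    unfolding ab(4)
    by (rule ext) (simp only: comp_apply inj_transpose_apply[OF inj_transpose, of k "Suc k" a b])
  have sv: "(?s \<circ> v) permutes {1..m}" by (rule adj_swap_comp_permutes[OF v k])
  have "perm_length m (?s \<circ> v) < perm_length m (?s \<circ> w)"
    unfolding conj
  proof (rule perm_length_transpose_less[OF sv])
    have "?s a \<in> {1..m}" "?s b \<in> {1..m}"
      using permutes_in_image[OF adj_swap_permutes[OF k]] ab by auto
    then show "1 \<le> ?s a" "?s b \<le> m" by auto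
    show "Suc (?s a) \<le> ?s b" using less by simp
    show "inv (?s \<circ> v) (?s a) < inv (?s \<circ> v) (?s b)"
      using ab by (simp add: inv_adj_swap_comp[OF v])
  qed
  then show False
    using perm_length_adj_swap[OF v k asc] perm_length_adj_swap_descent[OF w k desc]
      bruhat_step_length[OF vw] by linarith
qed

lemma inv_Suc_cases:
  assumes "p permutes {1..m}"
  obtains "inv p k < inv p (Suc k)" | "inv p (Suc k) < inv p k"
  using permutes_inj[OF permutes_inv[OF assms]] by (metis inj_def n_not_Suc_n nat_neq_iff)

text \<open>The lifting property, by induction along a chain from \<open>u\<close> to
  \<open>v\<close>. A step that keeps the ascent at \<open>k\<close> remains a step after
  multiplication by s. A step that turns the ascent into a descent is multiplication by s, by the
  exchange lemma.\<close>

lemma bruhat_lift: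
  assumes uv: "bruhat_le m u v" and k: "1 \<le> k" "k < m" and asc: "inv u k < inv u (Suc k)"
  shows "(inv v k < inv v (Suc k) \<longrightarrow> bruhat_le m (adj_swap k \<circ> u) (adj_swap k \<circ> v)) \<and>
    (inv v (Suc k) < inv v k \<longrightarrow> bruhat_le m (adj_swap k \<circ> u) v)"
  using uv
proof (induction rule: bruhat_le_induct)
  case refl
  then show ?case
    using asc bruhat_le_refl[OF adj_swap_comp_permutes[OF _ k]] by (metis less_asym)
next
  case (step v w)
  let ?s = "adj_swap k"
  have v: "v permutes {1..m}" and w: "w permutes {1..m}"
    using bruhat_step_permutes[OF step(2)] by auto
  show ?case
  proof (cases rule: inv_Suc_cases[OF v, of k])
    case 1
    then have le: "bruhat_le m (?s \<circ> u) (?s \<circ> v)" using step by blast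
    show ?thesis
    proof (cases rule: inv_Suc_cases[OF w, of k])
      assume w1: "inv w k < inv w (Suc k)"
      obtain a b where ab: "1 \<le> a" "a < b" "b \<le> m" "w = transpose a b \<circ> v"
        using step(2) by (rule bruhat_stepE)
      have conj: "?s \<circ> w = transpose (?s a) (?s b) \<circ> (?s \<circ> v)"
        unfolding ab(4)
    by (rule ext) (simp only: comp_apply inj_transpose_apply[OF inj_transpose, of k "Suc k" a b])
      have "bruhat_step m (?s \<circ> v) (?s \<circ> w)"
      proof -
        have "?s a \<in> {1..m}" "?s b \<in> {1..m}"
          using permutes_in_image[OF adj_swap_permutes[OF k]] ab by auto
        moreover have "?s a \<noteq> ?s b" using ab(2) transpose_eq_imp_eq nat_neq_iff by metis
        moreover have "perm_length m (?s \<circ> w) = perm_length m (?s \<circ> v) + 1"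
          using perm_length_adj_swap[OF v k 1] perm_length_adj_swap[OF w k w1]
            bruhat_step_length[OF step(2)] by linarith
        ultimately show ?thesis
          unfolding bruhat_step_def using adj_swap_comp_permutes[OF v k] conj by blast
      qed
      from bruhat_le_trans[OF le bruhat_le_step[OF this]] w1 show ?thesis by (metis less_asym)
    next
      assume "inv w (Suc k) < inv w k"
      with bruhat_step_exchange[OF step(2) k 1] le show ?thesis by (metis less_asym)
    qed
  next
    case 2
    then have "bruhat_le m (?s \<circ> u) w"
      using step bruhat_le_trans bruhat_le_step by blast
    then show ?thesis
      using bruhat_step_adj_swap[OF w k] bruhat_le_trans bruhat_le_step by blast
  qed
qed

section \<open>Rank matrices of permutations and the dominance criterion\<close>

definition corner_count :: "(nat \<Rightarrow> nat) \<Rightarrow> nat \<Rightarrow> nat \<Rightarrow> nat" where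
  "corner_count p i j = card {c. c \<le> i \<and> p c \<le> j}"

text \<open>The orientation is that of Bruhat order: the smaller permutation has the larger
  counts.\<close>

definition dominates :: "(nat \<Rightarrow> nat) \<Rightarrow> (nat \<Rightarrow> nat) \<Rightarrow> bool" where
  "dominates p r \<longleftrightarrow> (\<forall>i j. corner_count r i j \<le> corner_count p i j)"

lemma finite_corner: "finite {c. c \<le> (i::nat) \<and> P c}"
  by (rule finite_subset[of _ "{..i}"]) auto

lemma corner_count_Suc:
  assumes p: "bij p"
  shows "corner_count p i (Suc j) = corner_count p i j + (if inv p (Suc j) \<le> i then 1 else 0)"
proof -
  have *: "p c = Suc j \<longleftrightarrow> c = inv p (Suc j)" for c
    using bij_inv_eq_iff[OF p] by metis
  show ?thesis
  proof (cases "inv p (Suc j) \<le> i")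
    case True
    then have "{c. c \<le> i \<and> p c \<le> Suc j} = insert (inv p (Suc j)) {c. c \<le> i \<and> p c \<le> j}"
      using * by (auto simp: le_Suc_eq)
    moreover have "inv p (Suc j) \<notin> {c. c \<le> i \<and> p c \<le> j}"
      using *[of "inv p (Suc j)"] by auto
    ultimately show ?thesis
      using True finite_corner[of i] by (simp add: corner_count_def)
  next
    case False
    then have "{c. c \<le> i \<and> p c \<le> Suc j} = {c. c \<le> i \<and> p c \<le> j}"
      using * by (auto simp: le_Suc_eq)
    then show ?thesis using False by (simp add: corner_count_def)
  qed
qed

text \<open>The rank matrix of the inverse is the transpose, because \<open>p\<close> maps one
  counted set onto the other.\<close>

lemma corner_count_inv:
  assumes p: "p permutes A"
  shows "corner_count (inv p) i j = corner_count p j i"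
proof -
  have "{c. c \<le> i \<and> inv p c \<le> j} = p ` {c. c \<le> j \<and> p c \<le> i}"
    using permutes_inverses[OF p] by (auto intro!: image_eqI[of _ p "inv p _"])
  then show ?thesis
    unfolding corner_count_def using permutes_inj_on[OF p] by (simp add: card_image)
qed

lemma corner_count_adj_swap: "j \<noteq> k \<Longrightarrow> corner_count (adj_swap k \<circ> p) i j = corner_count p i j"
proof -
  assume "j \<noteq> k"
  then have "adj_swap k v \<le> j \<longleftrightarrow> v \<le> j" for v
    by (auto simp: transpose_def)
  then show ?thesis by (simp add: corner_count_def)
qed

lemma dominates_inv:
  "p permutes A \<Longrightarrow> r permutes A \<Longrightarrow> dominates p r \<Longrightarrow> dominates (inv p) (inv r)"
  by (simp add: dominates_def corner_count_inv)

lemma dominates_if_bruhat_step: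
  assumes "bruhat_step m p r"
  shows "dominates p r"
  unfolding dominates_def
proof (intro allI)
  fix i j
  obtain a b where ab: "a < b" "r = transpose a b \<circ> p" "inv p a < inv p b"
    using assms by (rule bruhat_stepE)
  have p: "p permutes {1..m}" using bruhat_step_permutes[OF assms] by simp
  have p_eq: "p c = v \<longleftrightarrow> c = inv p v" for c v
    using permutes_inv_eq[OF p] by metis
  show "corner_count r i j \<le> corner_count p i j"
  proof (cases "b \<le> j")
    case True
    then have "{c. c \<le> i \<and> r c \<le> j} \<subseteq> {c. c \<le> i \<and> p c \<le> j}"
      using ab by (auto simp: transpose_def split: if_splits)
    then show ?thesis
      unfolding corner_count_def by (intro card_mono finite_corner)
  next
    case False
    \<comment> \<open>Only the position of \<open>b\<close>, which now carries \<open>a\<close>, can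
      newly enter the count. It is charged to the position of \<open>a\<close>, which lies further
      left and leaves the count because it now carries \<open>b > j\<close>.\<close>
    let ?f = "\<lambda>c. if c = inv p b then inv p a else c"
    have "r (inv p a) = b" using ab permutes_inverses[OF p] by simp
    then have "inj_on ?f {c. c \<le> i \<and> r c \<le> j}"
      using False by (auto simp: inj_on_def)
    moreover have "p c \<le> j" if "r c \<le> j" "c \<noteq> inv p b" for c
      using that ab p_eq False by (auto simp: transpose_def split: if_splits)
    moreover have "a \<le> j" if "r (inv p b) \<le> j"
      using that ab permutes_inverses[OF p] by simp
    ultimately show ?thesis
      unfolding corner_count_def
      by (intro card_inj_on_le[of ?f] finite_corner)
        (use ab permutes_inverses[OF p] in auto)
  qed
qed

lemma dominates_if_bruhat_le: "bruhat_le m p r \<Longrightarrow> dominates p r"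
proof (induction rule: bruhat_le_induct)
  case refl
  then show ?case by (simp add: dominates_def)
next
  case (step q r)
  then show ?case
    using dominates_if_bruhat_step[OF step(2)] unfolding dominates_def by (meson order_trans)
qed

text \<open>Multiplication by s changes only the counts with \<open>j = k\<close>. The new
  inequality there follows from the old ones at k - 1 and k + 1: if the permutation on the left
  gains nothing from k - 1 to k, its ascent forbids a gain up to k + 1 too.\<close>

lemma dominates_lift:
  assumes xy: "dominates x y" and x: "x permutes {1..m}" and y: "y permutes {1..m}"
    and k: "1 \<le> k" and desc: "inv y (Suc k) < inv y k"
  shows "inv x k < inv x (Suc k) \<Longrightarrow> dominates x (adj_swap k \<circ> y)"
    and "inv x (Suc k) < inv x k \<Longrightarrow> dominates (adj_swap k \<circ> x) (adj_swap k \<circ> y)"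
proof -
  let ?s = "adj_swap k"
  obtain l where l: "k = Suc l" using k by (cases k) auto
  have rec: "corner_count p i k = corner_count p i l + (if inv p k \<le> i then 1 else 0)"
    "corner_count p i (Suc k) = corner_count p i k + (if inv p (Suc k) \<le> i then 1 else 0)"
    "corner_count (?s \<circ> p) i k = corner_count p i l + (if inv p (Suc k) \<le> i then 1 else 0)"
    if p: "p permutes {1..m}" for p i
  proof -
    have "bij p" and sp: "bij (?s \<circ> p)"
      using permutes_bij[OF p] by (auto intro: bij_comp)
    then show "corner_count p i k = corner_count p i l + (if inv p k \<le> i then 1 else 0)"
      "corner_count p i (Suc k) = corner_count p i k + (if inv p (Suc k) \<le> i then 1 else 0)"
      using corner_count_Suc l by blast+
    have "corner_count (?s \<circ> p) i l = corner_count p i l"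
      by (rule corner_count_adj_swap) (simp add: l)
    moreover have "inv (?s \<circ> p) k = inv p (Suc k)"
      unfolding inv_adj_swap_comp[OF p] by simp
    ultimately show "corner_count (?s \<circ> p) i k = corner_count p i l + (if inv p (Suc k) \<le> i then 1 else 0)"
      using corner_count_Suc[OF sp, of i l] unfolding l by metis
  qed
  have le: "corner_count y i j \<le> corner_count x i j" for i j
    using xy by (auto simp: dominates_def)
  show "dominates x (?s \<circ> y)" if "inv x k < inv x (Suc k)"
    unfolding dominates_def
  proof (intro allI)
    fix i j
    show "corner_count (?s \<circ> y) i j \<le> corner_count x i j"
    proof (cases "j = k")
      case True
      show ?thesis
        unfolding True using le[of i l] le[of i k] le[of i "Suc k"] rec[OF x, of i] rec[OF y, of i] that desc
        by (auto split: if_splits)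
    qed (simp only: corner_count_adj_swap le not_False_eq_True)
  qed
  show "dominates (?s \<circ> x) (?s \<circ> y)" if "inv x (Suc k) < inv x k"
    unfolding dominates_def
  proof (intro allI)
    fix i j
    show "corner_count (?s \<circ> y) i j \<le> corner_count (?s \<circ> x) i j"
    proof (cases "j = k")
      case True
      show ?thesis
        unfolding True using le[of i l] le[of i k] le[of i "Suc k"] rec[OF x, of i] rec[OF y, of i] that desc
        by (auto split: if_splits)
    qed (simp only: corner_count_adj_swap le not_False_eq_True)
  qed
qed

text \<open>The inverse is then increasing on {1..m}, so no point is mapped below itself, which
  forces the identity.\<close>

lemma eq_id_if_no_descent:
  assumes y: "y permutes {1..m}"
    and asc: "\<And>k. 1 \<le> k \<Longrightarrow> k < m \<Longrightarrow> inv y k < inv y (Suc k)"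
  shows "y = id"
proof -
  have iy: "inv y permutes {1..m}" by (rule permutes_inv[OF y])
  have "i \<le> inv y i" if "1 \<le> i" "i \<le> m" for i
    using that
  proof (induction i rule: dec_induct)
    case base
    then show ?case using permutes_in_image[OF iy, of 1] by auto
  next
    case (step i)
    then show ?case using asc[of i] by auto
  qed
  then have "inv y = id"
    by (intro permutes_natset_ge[OF iy]) auto
  then show ?thesis
    using permutes_inv_inv[OF y] by simp
qed

text \<open>The diagonal counts of \<open>id\<close> are as large as possible, so \<open>x\<close>
  must map each initial segment into itself.\<close>

lemma eq_id_if_dominates_id:
  assumes x: "x permutes {1..m}" and dom: "dominates x id"
  shows "x = id"
proof (rule permutes_natset_le[OF x], rule ballI)
  fix i
  have "card {..i} \<le> card {c. c \<le> i \<and> x c \<le> i}"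
    using dom[unfolded dominates_def corner_count_def, rule_format, of i i] by (simp add: atMost_def)
  moreover have "{c. c \<le> i \<and> x c \<le> i} \<subseteq> {..i}" by auto
  ultimately have "{c. c \<le> i \<and> x c \<le> i} = {..i}"
    by (intro card_seteq) auto
  then show "x i \<le> i" by auto
qed

text \<open>Induction on the length of \<open>y\<close>: a descent of \<open>y\<close> is removed,
  and if \<open>x\<close> has it too, it is removed there as well. Dominance survives, and the
  lifting property carries the resulting Bruhat relation back up.\<close>

lemma bruhat_le_if_dominates:
  assumes "x permutes {1..m}" "y permutes {1..m}" "dominates x y"
  shows "bruhat_le m x y"
  using assms
proof (induction "perm_length m y" arbitrary: x y rule: less_induct)
  case less
  note x = less.prems(1) and y = less.prems(2)
  show ?case
  proof (cases "\<exists>k. 1 \<le> k \<and> k < m \<and> inv y (Suc k) < inv y k")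
    case True
    then obtain k where k: "1 \<le> k" "k < m" and desc: "inv y (Suc k) < inv y k" by auto
    let ?s = "adj_swap k"
    have sy: "?s \<circ> y permutes {1..m}" and sx: "?s \<circ> x permutes {1..m}"
      using adj_swap_comp_permutes x y k by blast+
    have len: "perm_length m (?s \<circ> y) < perm_length m y"
      using perm_length_adj_swap_descent[OF y k desc] by linarith
    have asc: "inv (?s \<circ> y) k < inv (?s \<circ> y) (Suc k)"
      unfolding inv_adj_swap_comp[OF y] using desc by simp
    have sy_le: "bruhat_le m (?s \<circ> y) y"
      using bruhat_le_step[OF bruhat_step_adj_swap[OF sy k asc]] by (simp only: adj_swap_comp_idem)
    show ?thesis
    proof (cases rule: inv_Suc_cases[OF x, of k])
      case 1
      have "bruhat_le m x (?s \<circ> y)"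
        by (rule less.hyps[OF len x sy dominates_lift(1)[OF less.prems(3) x y k(1) desc 1]])
      then show ?thesis using sy_le bruhat_le_trans by blast
    next
      case 2
      have le: "bruhat_le m (?s \<circ> x) (?s \<circ> y)"
        by (rule less.hyps[OF len sx sy dominates_lift(2)[OF less.prems(3) x y k(1) desc 2]])
      have "inv (?s \<circ> x) k < inv (?s \<circ> x) (Suc k)"
        unfolding inv_adj_swap_comp[OF x] using 2 by simp
      from bruhat_lift[OF le k this] asc show ?thesis
        by (simp only: adj_swap_comp_idem)
    qed
  next
    case False
    then have "y = id"
      using inv_Suc_cases[OF y] by (intro eq_id_if_no_descent[OF y]) blast
    with less.prems(3) eq_id_if_dominates_id[OF x] show ?thesis
      using x by (simp add: bruhat_le_refl)
  qed
qed

subsection \<open>Gradedness of the fixed-point-free involutions\<close>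

text \<open>The bracketing presents conjugation as left multiplication of
  \<open>t \<circ> adj_swap k\<close>. The latter is the inverse of
  \<open>adj_swap k \<circ> t\<close>, so left multiplication is all that has to be studied.\<close>

definition adj_conj :: "nat \<Rightarrow> (nat \<Rightarrow> nat) \<Rightarrow> nat \<Rightarrow> nat" where
  "adj_conj k t = adj_swap k \<circ> (t \<circ> adj_swap k)"

lemma adj_conj_idem: "adj_conj k (adj_conj k t) = t"
  by (simp add: adj_conj_def fun_eq_iff)

lemma adj_conj_apply [simp]: "adj_conj k t v = adj_swap k (t (adj_swap k v))"
  by (simp add: adj_conj_def)

lemma fpf_permutes: "t \<in> fpf_involutions m \<Longrightarrow> t permutes {1..m}"
  by (simp add: fpf_involutions_def)

lemma fpf_invol [simp]: "t \<in> fpf_involutions m \<Longrightarrow> t (t i) = i"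
  by (auto simp: fpf_involutions_def fun_eq_iff)

lemma fpf_inv: "t \<in> fpf_involutions m \<Longrightarrow> inv t = t"
  by (rule inv_unique_comp) (auto simp: fpf_involutions_def)

lemma fpf_eq_iff: "t \<in> fpf_involutions m \<Longrightarrow> t i = t j \<longleftrightarrow> i = j"
  using fpf_invol by metis

lemma fpf_neq: "t \<in> fpf_involutions m \<Longrightarrow> 1 \<le> i \<Longrightarrow> i \<le> m \<Longrightarrow> t i \<noteq> i"
  by (auto simp: fpf_involutions_def)

lemma fpf_range:
  assumes "t \<in> fpf_involutions m" "1 \<le> i" "i \<le> m"
  shows "1 \<le> t i" "t i \<le> m"
  using permutes_in_image[OF fpf_permutes[OF assms(1)], of i] assms(2,3) by auto

lemma fpf_inv_comp_adj_swap:
  assumes t: "t \<in> fpf_involutions m"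
  shows "inv (t \<circ> adj_swap k) = adj_swap k \<circ> t" "inv (adj_swap k \<circ> t) = t \<circ> adj_swap k"
  by (rule inv_unique_comp; use t in \<open>simp add: fun_eq_iff\<close>)+

lemma fpf_comp_adj_swap_permutes:
  assumes t: "t \<in> fpf_involutions m" and k: "1 \<le> k" "k < m"
  shows "(t \<circ> adj_swap k) permutes {1..m}"
  by (rule permutes_compose[OF adj_swap_permutes[OF k] fpf_permutes[OF t]])

text \<open>Here (k k+1) is a 2-cycle of \<open>x\<close>, so conjugation by it leaves
  \<open>x\<close> unchanged.\<close>

lemma fpf_comp_adj_swap_commute:
  assumes x: "x \<in> fpf_involutions m" and xk: "x k = Suc k"
  shows "x \<circ> adj_swap k = adj_swap k \<circ> x"
proof
  fix v
  have xSk: "x (Suc k) = k" using fpf_invol[OF x, of k] xk by simp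
  have "x v = Suc k \<longleftrightarrow> v = k" "x v = k \<longleftrightarrow> v = Suc k"
    using fpf_eq_iff[OF x] xk xSk by metis+
  then show "(x \<circ> adj_swap k) v = (adj_swap k \<circ> x) v"
    using xk xSk by (cases "v = k \<or> v = Suc k") auto
qed

lemma adj_conj_fpf:
  assumes t: "t \<in> fpf_involutions m" and k: "1 \<le> k" "k < m"
  shows "adj_conj k t \<in> fpf_involutions m"
  unfolding fpf_involutions_def
proof (intro CollectI conjI ballI)
  show "adj_conj k t permutes {1..m}"
    unfolding adj_conj_def
    by (rule adj_swap_comp_permutes[OF fpf_comp_adj_swap_permutes[OF t k] k])
  show "adj_conj k t \<circ> adj_conj k t = id"
    using t by (simp add: fun_eq_iff)
  fix i assume "i \<in> {1..m}"
  then have "adj_swap k i \<in> {1..m}"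
    using permutes_in_image[OF adj_swap_permutes[OF k]] by blast
  then have "t (adj_swap k i) \<noteq> adj_swap k i"
    using fpf_neq[OF t] by auto
  then show "adj_conj k t i \<noteq> i"
    by (metis adj_conj_apply transpose_involutory)
qed

text \<open>The claim compares s(t k) with s(t (k+1)). The swap could reverse this ascent only if
  \<open>k\<close> and \<open>Suc k\<close> were fixed points. Dually, for the descent below, only
  the 2-cycle (k k+1) is harmful.\<close>

lemma fpf_ascent_comp:
  assumes t: "t \<in> fpf_involutions m" and k: "1 \<le> k" "k < m" and asc: "t k < t (Suc k)"
  shows "inv (t \<circ> adj_swap k) k < inv (t \<circ> adj_swap k) (Suc k)"
proof -
  have "t k \<noteq> k" using fpf_neq[OF t, of k] k by simp
  then show ?thesis
    using adj_swap_less_iff[of "t k" "t (Suc k)" k] asc by (auto simp: fpf_inv_comp_adj_swap[OF t])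
qed

lemma fpf_descent_comp:
  assumes t: "t \<in> fpf_involutions m" and desc: "t (Suc k) < t k" "t k \<noteq> Suc k"
  shows "inv (t \<circ> adj_swap k) (Suc k) < inv (t \<circ> adj_swap k) k"
  using adj_swap_less_iff[of "t (Suc k)" "t k" k] desc by (auto simp: fpf_inv_comp_adj_swap[OF t])

text \<open>Both t < t s and t s < s t s are Bruhat steps; the first is the inverse of the step from
  t to s t.\<close>

lemma adj_conj_ascent:
  assumes t: "t \<in> fpf_involutions m" and k: "1 \<le> k" "k < m" and asc: "t k < t (Suc k)"
  shows "perm_length m (adj_conj k t) = perm_length m t + 2" "bruhat_le m t (adj_conj k t)"
proof -
  let ?s = "adj_swap k"
  have p: "t permutes {1..m}" by (rule fpf_permutes[OF t])
  have q: "(t \<circ> ?s) permutes {1..m}" by (rule fpf_comp_adj_swap_permutes[OF t k])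
  have asc': "inv t k < inv t (Suc k)" using asc fpf_inv[OF t] by simp
  have asc_q: "inv (t \<circ> ?s) k < inv (t \<circ> ?s) (Suc k)"
    by (rule fpf_ascent_comp[OF t k asc])
  have "perm_length m (t \<circ> ?s) = perm_length m (?s \<circ> t)"
    using perm_length_inv[OF q] fpf_inv_comp_adj_swap[OF t] by metis
  then show "perm_length m (adj_conj k t) = perm_length m t + 2"
    unfolding adj_conj_def
    using perm_length_adj_swap[OF p k asc'] perm_length_adj_swap[OF q k asc_q] by linarith
  have "bruhat_le m (inv t) (inv (?s \<circ> t))"
    by (rule bruhat_le_inv[OF bruhat_le_step[OF bruhat_step_adj_swap[OF p k asc']]])
  then have "bruhat_le m t (t \<circ> ?s)"
    by (simp only: fpf_inv[OF t] fpf_inv_comp_adj_swap[OF t])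
  moreover have "bruhat_le m (t \<circ> ?s) (adj_conj k t)"
    unfolding adj_conj_def by (rule bruhat_le_step[OF bruhat_step_adj_swap[OF q k asc_q]])
  ultimately show "bruhat_le m t (adj_conj k t)"
    by (rule bruhat_le_trans)
qed

lemma adj_conj_descent:
  assumes t: "t \<in> fpf_involutions m" and k: "1 \<le> k" "k < m" and desc: "t (Suc k) < t k" "t k \<noteq> Suc k"
  shows "adj_conj k t k < adj_conj k t (Suc k)"
    "perm_length m t = perm_length m (adj_conj k t) + 2" "bruhat_le m (adj_conj k t) t"
proof -
  show asc: "adj_conj k t k < adj_conj k t (Suc k)"
    using adj_swap_less_iff[of "t (Suc k)" "t k" k] desc by auto
  show "perm_length m t = perm_length m (adj_conj k t) + 2" "bruhat_le m (adj_conj k t) t"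
    using adj_conj_ascent[OF adj_conj_fpf[OF t k] k asc] by (simp_all only: adj_conj_idem)
qed

section \<open>Involutions of minimal length and the parity of lengths\<close>

lemma odd_even_pair:
  fixes v n :: nat
  assumes "1 \<le> v" "v \<le> 2 * n"
  shows "\<exists>a<n. v = 2 * a + 1 \<or> v = 2 * a + 2"
  using assms by (intro exI[of _ "(v - 1) div 2"]) presburger

text \<open>If every descent comes from a 2-cycle (k k+1), then \<open>t\<close> is (1 2)(3
  4)...(2n-1 2n). By induction the points up to 2a are paired among themselves, so 2a + 1 has a
  larger partner.\<close>

lemma fpf_no_descent:
  assumes t: "t \<in> fpf_involutions (2 * n)"
    and nd: "\<And>k. 1 \<le> k \<Longrightarrow> k < 2 * n \<Longrightarrow> t (Suc k) < t k \<Longrightarrow> t k = Suc k"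
    and a: "a < n"
  shows "t (2 * a + 1) = 2 * a + 2"
  using a
proof (induction a rule: less_induct)
  case (less a)
  have below: "t v \<le> 2 * a" if v: "1 \<le> v" "v \<le> 2 * a" for v
  proof -
    obtain b where b: "b < a" "v = 2 * b + 1 \<or> v = 2 * b + 2"
      using odd_even_pair[OF v] by blast
    have "t (2 * b + 1) = 2 * b + 2" using less b by auto
    moreover from this have "t (2 * b + 2) = 2 * b + 1" using t by (metis fpf_invol)
    ultimately show ?thesis using b by auto
  qed
  let ?i = "2 * a + 1"
  let ?j = "t ?i"
  have i: "1 \<le> ?i" "?i \<le> 2 * n" using less.prems by auto
  have above: "t v > 2 * a" if "v > 2 * a" "v \<le> 2 * n" for v
    using below[of "t v"] fpf_invol[OF t, of v] fpf_range[OF t, of v] that by (cases "t v \<le> 2 * a") auto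
  have j: "?j > ?i" using above[of ?i] fpf_neq[OF t i] i by auto
  show ?case
  proof (rule ccontr)
    assume "?j \<noteq> 2 * a + 2"
    with j have jj: "?j > 2 * a + 2" by auto
    \<comment> \<open>Just before the partner of 2a + 1 there would be a descent, since every other
      point above 2a has a value above 2a + 1. Such a descent is a 2-cycle, which makes
      \<open>k\<close> itself equal to 2a + 1.\<close>
    define k where "k = ?j - 1"
    have k: "Suc k = ?j" "k > ?i" "k < 2 * n" using jj fpf_range[OF t i] by (auto simp: k_def)
    have tj: "t (Suc k) = ?i" using fpf_invol[OF t] k by simp
    have "t k \<noteq> ?i" using fpf_eq_iff[OF t, of k "Suc k"] tj by auto
    with above[of k] k tj have "t (Suc k) < t k" by auto
    from nd[OF _ _ this] k have "t k = Suc k" by auto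
    then have "k = ?i" using tj fpf_invol[OF t, of k] by simp
    with k show False by simp
  qed
qed

lemma fpf_no_descent_length:
  assumes t: "t \<in> fpf_involutions (2 * n)"
    and nd: "\<And>k. 1 \<le> k \<Longrightarrow> k < 2 * n \<Longrightarrow> t (Suc k) < t k \<Longrightarrow> t k = Suc k"
  shows "perm_length (2 * n) t = n"
proof -
  have odd: "t (2 * a + 1) = 2 * a + 2" if "a < n" for a
    using fpf_no_descent[OF t nd that] .
  have even: "t (2 * a + 2) = 2 * a + 1" if "a < n" for a
    using odd[OF that] t by (metis fpf_invol)
  have pair: "\<exists>a<n. v = 2 * a + 1 \<or> v = 2 * a + 2" if "1 \<le> v" "v \<le> 2 * n" for v
    using odd_even_pair that by blast
  have "{(i, j). i \<in> {1..2 * n} \<and> j \<in> {1..2 * n} \<and> i < j \<and> t i > t j} =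
    (\<lambda>a. (2 * a + 1, 2 * a + 2)) ` {..<n}" (is "?L = ?R")
  proof (rule set_eqI, clarify)
    fix i j
    show "(i, j) \<in> ?L \<longleftrightarrow> (i, j) \<in> ?R"
    proof
      assume L: "(i, j) \<in> ?L"
      then obtain a b where ab: "a < n" "i = 2 * a + 1 \<or> i = 2 * a + 2"
        "b < n" "j = 2 * b + 1 \<or> j = 2 * b + 2"
        using pair[of i] pair[of j] by auto
      then have "a = b \<and> i = 2 * a + 1 \<and> j = 2 * a + 2"
        using L odd[of a] odd[of b] even[of a] even[of b] by auto
      then show "(i, j) \<in> ?R" using ab by auto
    next
      assume "(i, j) \<in> ?R"
      then obtain a where "a < n" "i = 2 * a + 1" "j = 2 * a + 2" by auto
      then show "(i, j) \<in> ?L" using odd[of a] even[of a] by auto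
    qed
  qed
  moreover have "inj_on (\<lambda>a::nat. (2 * a + 1, 2 * a + 2)) {..<n}"
    by (auto simp: inj_on_def)
  ultimately show ?thesis
    unfolding perm_length_def by (simp add: card_image)
qed

lemma fpf_descent_cases:
  assumes "t \<in> fpf_involutions (2 * n)"
  obtains "perm_length (2 * n) t = n"
  | k where "1 \<le> k" "k < 2 * n" "t (Suc k) < t k" "t k \<noteq> Suc k"
  using fpf_no_descent_length[OF assms] by blast

lemma fpf_length:
  assumes "t \<in> fpf_involutions (2 * n)"
  obtains d where "perm_length (2 * n) t = n + 2 * d"
  using assms
proof (induction "perm_length (2 * n) t" arbitrary: t thesis rule: less_induct)
  case less
  show ?case
  proof (cases rule: fpf_descent_cases[OF less.prems(2)])
    case 1
    then show ?thesis using less.prems(1)[of 0] by simp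
  next
    case (2 k)
    note d = adj_conj_descent[OF less.prems(2) 2]
    obtain e where "perm_length (2 * n) (adj_conj k t) = n + 2 * e"
      by (rule less.hyps[OF _ _ adj_conj_fpf[OF less.prems(2) 2(1,2)]]) (use d in auto)
    then show ?thesis using d less.prems(1)[of "Suc e"] by simp
  qed
qed

section \<open>Lifting Bruhat order and dominance through conjugation\<close>

lemma bruhat_le_adj_conj_mono:
  assumes u: "u \<in> fpf_involutions m" and v: "v \<in> fpf_involutions m" and le: "bruhat_le m u v"
    and k: "1 \<le> k" "k < m" and asc: "u k < u (Suc k)" "v k < v (Suc k)"
  shows "bruhat_le m (adj_conj k u) (adj_conj k v)"
proof -
  let ?s = "adj_swap k"
  have "bruhat_le m (?s \<circ> u) (?s \<circ> v)"
    using bruhat_lift[OF le k] asc fpf_inv[OF u] fpf_inv[OF v] by metis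
  \<comment> \<open>Inversion moves the factor s to the right, so that a second lift on the left
    completes the conjugation.\<close>
  from bruhat_le_inv[OF this] have "bruhat_le m (u \<circ> ?s) (v \<circ> ?s)"
    by (simp only: fpf_inv_comp_adj_swap[OF u] fpf_inv_comp_adj_swap[OF v])
  from bruhat_lift[OF this k fpf_ascent_comp[OF u k asc(1)]] fpf_ascent_comp[OF v k asc(2)]
  show ?thesis by (simp only: adj_conj_def)
qed

lemma bruhat_le_adj_conj_left:
  assumes u: "u \<in> fpf_involutions m" and v: "v \<in> fpf_involutions m" and le: "bruhat_le m u v"
    and k: "1 \<le> k" "k < m" and asc: "u k < u (Suc k)" and desc: "v (Suc k) < v k"
  shows "bruhat_le m (adj_conj k u) v"
proof -
  let ?s = "adj_swap k"
  have "bruhat_le m (?s \<circ> u) v"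
    using bruhat_lift[OF le k] asc desc fpf_inv[OF u] fpf_inv[OF v] by metis
  from bruhat_le_inv[OF this] have "bruhat_le m (u \<circ> ?s) v"
    by (simp only: fpf_inv_comp_adj_swap[OF u] fpf_inv[OF v])
  from bruhat_lift[OF this k fpf_ascent_comp[OF u k asc]] desc
  show ?thesis by (simp only: adj_conj_def fpf_inv[OF v])
qed

text \<open>Two applications of \<open>dominates_lift\<close> with an inversion between them. If
  \<open>x k = Suc k\<close>, the first one lowers \<open>x\<close> to s x, which is its own inverse
  and has an ascent at \<open>k\<close>, so the second one leaves it alone.\<close>

lemma dominates_adj_conj:
  assumes x: "x \<in> fpf_involutions m" and y: "y \<in> fpf_involutions m" and dom: "dominates x y"
    and k: "1 \<le> k" "k < m" and desc: "y (Suc k) < y k" "y k \<noteq> Suc k"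
  shows "x k < x (Suc k) \<Longrightarrow> dominates x (adj_conj k y)"
    and "x (Suc k) < x k \<Longrightarrow> x k \<noteq> Suc k \<Longrightarrow> dominates (adj_conj k x) (adj_conj k y)"
    and "x k = Suc k \<Longrightarrow> dominates (adj_swap k \<circ> x) (adj_conj k y)"
proof -
  let ?s = "adj_swap k"
  have px: "x permutes {1..m}" and py: "y permutes {1..m}"
    using x y by (auto dest: fpf_permutes)
  have psx: "?s \<circ> x permutes {1..m}" and psy: "?s \<circ> y permutes {1..m}"
    using adj_swap_comp_permutes px py k by blast+
  have pxs: "x \<circ> ?s permutes {1..m}" and pys: "y \<circ> ?s permutes {1..m}"
    using fpf_comp_adj_swap_permutes x y k by blast+
  have desc': "inv y (Suc k) < inv y k" using desc fpf_inv[OF y] by simp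
  note desc_ys = fpf_descent_comp[OF y desc]
  note lift1 = dominates_lift[OF dom px py k(1) desc']
  show "dominates x (adj_conj k y)" if "x k < x (Suc k)"
  proof -
    have asc: "inv x k < inv x (Suc k)" using that fpf_inv[OF x] by simp
    have "dominates x (y \<circ> ?s)"
      using dominates_inv[OF px psy lift1(1)[OF asc]]
      by (simp only: fpf_inv[OF x] fpf_inv_comp_adj_swap[OF y])
    from dominates_lift(1)[OF this px pys k(1) desc_ys asc]
    show ?thesis by (simp only: adj_conj_def)
  qed
  have lower: "dominates (inv (?s \<circ> x)) (y \<circ> ?s)" if "x (Suc k) < x k"
    using dominates_inv[OF psx psy lift1(2)] that fpf_inv[OF x] fpf_inv_comp_adj_swap[OF y]
    by metis
  show "dominates (adj_conj k x) (adj_conj k y)" if "x (Suc k) < x k" "x k \<noteq> Suc k"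
  proof -
    have "dominates (x \<circ> ?s) (y \<circ> ?s)"
      using lower[OF that(1)] by (simp only: fpf_inv_comp_adj_swap[OF x])
    from dominates_lift(2)[OF this pxs pys k(1) desc_ys fpf_descent_comp[OF x that]]
    show ?thesis by (simp only: adj_conj_def)
  qed
  show "dominates (?s \<circ> x) (adj_conj k y)" if xk: "x k = Suc k"
  proof -
    have xSk: "x (Suc k) = k" using fpf_invol[OF x, of k] xk by simp
    note comm = fpf_comp_adj_swap_commute[OF x xk]
    have "dominates (?s \<circ> x) (y \<circ> ?s)"
      using lower xk xSk comm fpf_inv_comp_adj_swap[OF x] by (metis lessI)
    moreover have "inv (?s \<circ> x) k < inv (?s \<circ> x) (Suc k)"
      using fpf_inv_comp_adj_swap(2)[OF x] xk xSk by simp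
    ultimately have "dominates (?s \<circ> x) (?s \<circ> (y \<circ> ?s))"
      using dominates_lift(1)[OF _ psx pys k(1) desc_ys] by blast
    then show ?thesis by (simp only: adj_conj_def)
  qed
qed

section \<open>Parity of the diagonal counts\<close>

lemma even_card_fpf_closed:
  assumes t: "t \<in> fpf_involutions m" and A: "finite A" "A \<subseteq> {1..m}" "t ` A \<subseteq> A"
  shows "even (card A)"
proof -
  let ?L = "{c \<in> A. c < t c}" and ?G = "{c \<in> A. t c < c}"
  \<comment> \<open>The involution exchanges the smaller and the larger element of each
    2-cycle.\<close>
  have "?G = t ` ?L"
  proof
    show "?G \<subseteq> t ` ?L"
    proof
      fix c assume "c \<in> ?G"
      then show "c \<in> t ` ?L"
        using t A(3) by (intro image_eqI[of _ _ "t c"]) auto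
    qed
  qed (use t A(3) in auto)
  moreover have "inj_on t ?L" using fpf_eq_iff[OF t] by (auto simp: inj_on_def)
  ultimately have "card ?G = card ?L" by (simp add: card_image)
  moreover have "A = ?L \<union> ?G" using fpf_neq[OF t] A(2) by (fastforce simp: neq_iff)
  then have "card A = card (?L \<union> ?G)" by simp
  then have "card A = card ?L + card ?G"
    using A(1) by (subst (asm) card_Un_disjoint) auto
  ultimately show ?thesis by simp
qed

text \<open>The points of {1..k} with value at most \<open>k\<close> are closed under
  \<open>t\<close>, hence even in number. The point 0, which \<open>corner_count\<close> includes
  and \<open>t\<close> fixes, makes the count odd.\<close>

lemma odd_corner_count:
  assumes t: "t \<in> fpf_involutions m" and k: "k \<le> m"
  shows "odd (corner_count t k k)"
proof -
  have t0: "t 0 = 0" using fpf_permutes[OF t] by (auto simp: permutes_def)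
  have "{c. c \<le> k \<and> t c \<le> k} = insert 0 {c \<in> {1..k}. t c \<le> k}"
    using t0 by auto
  then have "corner_count t k k = Suc (card {c \<in> {1..k}. t c \<le> k})"
    unfolding corner_count_def by (subst card_insert_disjoint[symmetric]) auto
  moreover have "even (card {c \<in> {1..k}. t c \<le> k})"
  proof (rule even_card_fpf_closed[OF t])
    show "t ` {c \<in> {1..k}. t c \<le> k} \<subseteq> {c \<in> {1..k}. t c \<le> k}"
      using fpf_range(1)[OF t] k t by auto
  qed (use k in auto)
  ultimately show ?thesis by simp
qed

lemma dominates_if_adj_swap_comp_dominates:
  assumes x: "x \<in> fpf_involutions m" and w: "w \<in> fpf_involutions m"
    and k: "1 \<le> k" "k < m" and xk: "x k = Suc k"
    and dom: "dominates (adj_swap k \<circ> x) w"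
  shows "dominates x w"
  unfolding dominates_def
proof (intro allI)
  fix i j
  let ?s = "adj_swap k"
  have le: "corner_count w i j \<le> corner_count (?s \<circ> x) i j" for i j
    using dom by (auto simp: dominates_def)
  have xSk: "x (Suc k) = k" using fpf_invol[OF x, of k] xk by simp
  note comm = fpf_comp_adj_swap_commute[OF x xk]
  have psx: "?s \<circ> x permutes {1..m}" by (rule adj_swap_comp_permutes[OF fpf_permutes[OF x] k])
  have inv_sx: "inv (?s \<circ> x) = ?s \<circ> x"
    using fpf_inv_comp_adj_swap(2)[OF x] comm by simp
  consider "j \<noteq> k" | "j = k" "i \<noteq> k" | "i = k" "j = k" by blast
  then show "corner_count w i j \<le> corner_count x i j"
  proof cases
    case 1
    then show ?thesis using le[of i j] corner_count_adj_swap[of j k x i] by linarith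
  next
    case 2
    \<comment> \<open>Both s x and x are involutions, so their rank matrices are symmetric;
      exchanging the indices reduces to a second index other than \<open>k\<close>.\<close>
    have "corner_count (?s \<circ> x) i k = corner_count (?s \<circ> x) k i"
      using corner_count_inv[OF psx, of i k] inv_sx by simp
    also have "\<dots> = corner_count x k i" by (rule corner_count_adj_swap[OF 2(2)])
    also have "\<dots> = corner_count x i k"
      using corner_count_inv[OF fpf_permutes[OF x], of i k] fpf_inv[OF x] by simp
    finally show ?thesis using le[of i k] 2 by simp
  next
    case 3
    \<comment> \<open>Since s x fixes \<open>k\<close> while \<open>x k = Suc k\<close>, exactly the
      point \<open>k\<close> enters the count.\<close>
    have "{c. c \<le> k \<and> (?s \<circ> x) c \<le> k} = insert k {c. c \<le> k \<and> x c \<le> k}"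
    proof (rule set_eqI)
      fix c
      have "x c = Suc k \<longleftrightarrow> c = k" "x c = k \<longleftrightarrow> c = Suc k"
        using fpf_eq_iff[OF x] xk xSk by metis+
      then show "c \<in> {c. c \<le> k \<and> (?s \<circ> x) c \<le> k} \<longleftrightarrow> c \<in> insert k {c. c \<le> k \<and> x c \<le> k}"
        by (auto simp: transpose_def)
    qed
    moreover have "k \<notin> {c. c \<le> k \<and> x c \<le> k}" using xk by simp
    ultimately have "corner_count (?s \<circ> x) k k = Suc (corner_count x k k)"
      using finite_corner[of k] by (simp add: corner_count_def)
    then have "corner_count w k k \<le> Suc (corner_count x k k)" using le[of k k] by simp
    \<comment> \<open>Two odd numbers cannot differ by exactly 1, so the slack of 1
      disappears.\<close>
    moreover have "odd (corner_count w k k)" "odd (corner_count x k k)"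
      using odd_corner_count x w k by auto
    ultimately have "corner_count w k k \<noteq> Suc (corner_count x k k)" by auto
    with \<open>corner_count w k k \<le> Suc (corner_count x k k)\<close> show ?thesis unfolding 3 by linarith
  qed
qed

lemma bruhat_le_adj_conj_right:
  assumes x: "x \<in> fpf_involutions m" and y: "y \<in> fpf_involutions m" and le: "bruhat_le m x y"
    and k: "1 \<le> k" "k < m" and desc: "y (Suc k) < y k" "y k \<noteq> Suc k"
    and xk: "x k < x (Suc k) \<or> x k = Suc k"
  shows "bruhat_le m x (adj_conj k y)"
proof (rule bruhat_le_if_dominates)
  note cy = adj_conj_fpf[OF y k]
  show "x permutes {1..m}" "adj_conj k y permutes {1..m}"
    using x cy by (auto dest: fpf_permutes)
  note dom = dominates_adj_conj[OF x y dominates_if_bruhat_le[OF le] k desc]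
  show "dominates x (adj_conj k y)"
    using xk dom(1) dominates_if_adj_swap_comp_dominates[OF x cy k _ dom(3)] by blast
qed

text \<open>Induction on the length of \<open>y\<close>, with a descent \<open>k\<close> of
  \<open>y\<close> outside its 2-cycles (k k+1). Either x <= s y s, or \<open>x\<close> can be
  lowered too; in the latter case the interpolant found between s x s and s y s is conjugated back
  when it has an ascent at \<open>k\<close>.\<close>

lemma fpf_interpolate:
  assumes "x \<in> fpf_involutions (2 * n)" "y \<in> fpf_involutions (2 * n)" "bruhat_le (2 * n) x y" "x \<noteq> y"
  obtains z where "z \<in> fpf_involutions (2 * n)" "bruhat_le (2 * n) x z" "bruhat_le (2 * n) z y"
    "perm_length (2 * n) z = perm_length (2 * n) x + 2"
  using assms
proof (induction "perm_length (2 * n) y" arbitrary: x y thesis rule: less_induct)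
  case less
  let ?m = "2 * n"
  note x = less.prems(2) and y = less.prems(3) and le = less.prems(4)
  have len_xy: "perm_length ?m x < perm_length ?m y"
    using bruhat_le_length[OF le] less.prems(5) by blast
  obtain dx where "perm_length ?m x = n + 2 * dx" by (rule fpf_length[OF x])
  with len_xy have "perm_length ?m y \<noteq> n" by simp
  then obtain k where k: "1 \<le> k" "k < ?m" and desc: "y (Suc k) < y k" "y k \<noteq> Suc k"
    using fpf_descent_cases[OF y] by metis
  let ?y = "adj_conj k y"
  note cy = adj_conj_fpf[OF y k] and ydesc = adj_conj_descent[OF y k desc]
  have len_y: "perm_length ?m ?y < perm_length ?m y" using ydesc(2) by simp
  \<comment> \<open>Either \<open>x\<close> equals s y s and \<open>y\<close> itself is the
    interpolant, or the induction hypothesis applies below s y s.\<close>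
  have below: thesis if le_cy: "bruhat_le ?m x ?y"
  proof (cases "x = ?y")
    case True
    then show thesis
      using less.prems(1)[OF y le bruhat_le_refl[OF fpf_permutes[OF y]]] ydesc(2) by simp
  next
    case False
    obtain z where "z \<in> fpf_involutions ?m" "bruhat_le ?m x z" "bruhat_le ?m z ?y"
      "perm_length ?m z = perm_length ?m x + 2"
      using less.hyps[OF len_y _ x cy le_cy False] by blast
    then show thesis using less.prems(1) bruhat_le_trans ydesc(3) by blast
  qed
  show thesis
  proof (cases "x k < x (Suc k) \<or> x k = Suc k")
    case True
    then show thesis using below bruhat_le_adj_conj_right[OF x y le k desc] by blast
  next
    case False
    then have xdesc: "x (Suc k) < x k" "x k \<noteq> Suc k"
      using fpf_eq_iff[OF x, of k "Suc k"] by auto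
    let ?x = "adj_conj k x"
    note cx = adj_conj_fpf[OF x k] and xd = adj_conj_descent[OF x k xdesc]
    have "bruhat_le ?m ?x ?y"
      using dominates_adj_conj(2)[OF x y dominates_if_bruhat_le[OF le] k desc xdesc] cx cy
      by (intro bruhat_le_if_dominates) (auto dest: fpf_permutes)
    moreover have "?x \<noteq> ?y"
      using less.prems(5) adj_conj_idem by metis
    ultimately obtain z where z: "z \<in> fpf_involutions ?m" "bruhat_le ?m ?x z" "bruhat_le ?m z ?y"
      "perm_length ?m z = perm_length ?m ?x + 2"
      using less.hyps[OF len_y _ cx cy] by blast
    show thesis
    proof (cases "z k < z (Suc k)")
      case True
      show thesis
      proof (rule less.prems(1))
        show "adj_conj k z \<in> fpf_involutions ?m" by (rule adj_conj_fpf[OF z(1) k])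
        show "bruhat_le ?m x (adj_conj k z)"
          using bruhat_le_adj_conj_mono[OF cx z(1,2) k xd(1) True] by (simp only: adj_conj_idem)
        show "bruhat_le ?m (adj_conj k z) y"
          using bruhat_le_adj_conj_mono[OF z(1) cy z(3) k True ydesc(1)] by (simp only: adj_conj_idem)
        show "perm_length ?m (adj_conj k z) = perm_length ?m x + 2"
          using adj_conj_ascent(1)[OF z(1) k True] z(4) xd(2) by simp
      qed
    next
      case False
      \<comment> \<open>At a descent of \<open>z\<close>, lifting s x s to \<open>x\<close> keeps it
        below \<open>z\<close>, hence below s y s, and the case already settled applies.\<close>
      then have "z (Suc k) < z k" using fpf_eq_iff[OF z(1), of k "Suc k"] by auto
      from bruhat_le_adj_conj_left[OF cx z(1,2) k xd(1) this]
      have "bruhat_le ?m x z" by (simp only: adj_conj_idem)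
      then show thesis using below bruhat_le_trans z(3) by blast
    qed
  qed
qed

text \<open>By \<open>fpf_length\<close> neither the natural-number subtraction nor the division
  truncates on fixed-point-free involutions.\<close>

definition fpf_rank :: "nat \<Rightarrow> (nat \<Rightarrow> nat) \<Rightarrow> nat" where
  "fpf_rank n t = (perm_length (2 * n) t - n) div 2"

lemma fpf_rank_Suc:
  assumes "x \<in> fpf_involutions (2 * n)" "perm_length (2 * n) y = perm_length (2 * n) x + 2"
  shows "fpf_rank n y = fpf_rank n x + 1"
  using assms(2) fpf_length[OF assms(1)] by (fastforce simp: fpf_rank_def)

text \<open>An element of length above n has a conjugate below it, so it is not minimal. In a cover
  of \<open>x\<close> by \<open>y\<close> the interpolant can only be \<open>y\<close>, so the
  length rises by exactly 2.\<close>

lemma is_rank_function_fpf_rank: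
  "is_rank_function (fpf_involutions (2 * n)) (bruhat_le (2 * n)) (fpf_rank n)"
  unfolding is_rank_function_def
proof (intro conjI allI ballI impI)
  fix x assume x: "x \<in> fpf_involutions (2 * n)"
    and min: "\<forall>y\<in>fpf_involutions (2 * n). bruhat_le (2 * n) y x \<longrightarrow> y = x"
  show "fpf_rank n x = 0"
  proof (cases rule: fpf_descent_cases[OF x])
    case 1
    then show ?thesis by (simp add: fpf_rank_def)
  next
    case (2 k)
    note d = adj_conj_descent[OF x 2]
    have "adj_conj k x = x" using min adj_conj_fpf[OF x 2(1,2)] d(3) by blast
    then show ?thesis using d(2) by simp
  qed
next
  fix x y assume cov: "poset_covers (fpf_involutions (2 * n)) (bruhat_le (2 * n)) x y"
  then have x: "x \<in> fpf_involutions (2 * n)"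
    and "y \<in> fpf_involutions (2 * n)" "bruhat_le (2 * n) x y" "x \<noteq> y"
    by (auto simp: poset_covers_def)
  then obtain z where z: "z \<in> fpf_involutions (2 * n)" "bruhat_le (2 * n) x z" "bruhat_le (2 * n) z y"
    "perm_length (2 * n) z = perm_length (2 * n) x + 2"
    by (rule fpf_interpolate)
  then have "z \<noteq> x" by auto
  with cov z have "z = y" by (auto simp: poset_covers_def)
  with z(4) x show "fpf_rank n y = fpf_rank n x + 1" by (intro fpf_rank_Suc) auto
qed

text \<open>The rank function chosen by \<open>SOME\<close> is determined on the poset: it vanishes
  at length n, and each lowering conjugation is a cover, so induction on the length applies.\<close>

lemma poset_rank_fpf:
  assumes "t \<in> fpf_involutions (2 * n)"
  shows "poset_rank (fpf_involutions (2 * n)) (bruhat_le (2 * n)) t = fpf_rank n t"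
proof -
  define r where "r = poset_rank (fpf_involutions (2 * n)) (bruhat_le (2 * n))"
  have r: "is_rank_function (fpf_involutions (2 * n)) (bruhat_le (2 * n)) r"
    unfolding r_def poset_rank_def using is_rank_function_fpf_rank by (metis someI)
  have "r t = fpf_rank n t"
    using assms
  proof (induction "perm_length (2 * n) t" arbitrary: t rule: less_induct)
    case less
    note t = less.prems
    show ?case
    proof (cases rule: fpf_descent_cases[OF t])
      case 1
      have "x = t" if x: "x \<in> fpf_involutions (2 * n)" and le: "bruhat_le (2 * n) x t" for x
        using fpf_length[OF x] bruhat_le_length[OF le] 1 by fastforce
      then have "r t = 0" using r t by (auto simp: is_rank_function_def)
      then show ?thesis using 1 by (simp add: fpf_rank_def)
    next
      case (2 k)
      let ?t = "adj_conj k t"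
      note d = adj_conj_descent[OF t 2] and ct = adj_conj_fpf[OF t 2(1,2)]
      have "poset_covers (fpf_involutions (2 * n)) (bruhat_le (2 * n)) ?t t"
        unfolding poset_covers_def
      proof (intro conjI notI)
        assume "\<exists>z\<in>fpf_involutions (2 * n). z \<noteq> ?t \<and> z \<noteq> t \<and> bruhat_le (2 * n) ?t z \<and> bruhat_le (2 * n) z t"
        then obtain z where z: "z \<in> fpf_involutions (2 * n)" "z \<noteq> ?t" "z \<noteq> t"
          "bruhat_le (2 * n) ?t z" "bruhat_le (2 * n) z t" by blast
        obtain d1 where "perm_length (2 * n) z = n + 2 * d1" by (rule fpf_length[OF z(1)])
        moreover obtain d2 where "perm_length (2 * n) t = n + 2 * d2" by (rule fpf_length[OF t])
        \<comment> \<open>All lengths are n plus an even number, so none lies strictly between two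
          that differ by 2.\<close>
        ultimately show False
          using bruhat_le_length[OF z(4)] bruhat_le_length[OF z(5)] z(2,3) d(2) by presburger
      qed (use t ct d in auto)
      then have "r t = r ?t + 1" using r by (auto simp: is_rank_function_def)
      also have "r ?t = fpf_rank n ?t" by (rule less.hyps[OF _ ct]) (use d(2) in auto)
      finally show ?thesis using fpf_rank_Suc[OF ct d(2)] by simp
    qed
  qed
  then show ?thesis by (simp add: r_def)
qed

subsection \<open>Weighted Dyck paths\<close>

text \<open>These rules would rewrite products with \<open>qvar\<close> to shifted coefficient lists.\<close>

declare mult_pCons_left [simp del] mult_pCons_right [simp del]

section \<open>Identities for q-integers\<close>

lemma q_bracket_sum: "q_bracket m = (\<Sum>i<m. qvar ^ i)"
proof -
  have "(1 - qvar) * q_bracket m = (1 - qvar) * (\<Sum>i<m. qvar ^ i)"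
    using q_bracket_times[of m] one_diff_power_eq[of qvar m] by simp
  moreover have "1 - qvar \<noteq> 0"
    by (simp add: one_pCons)
  ultimately show ?thesis by (metis mult_cancel_left)
qed

lemma q_bracket_0 [simp]: "q_bracket 0 = 0"
  by (simp add: q_bracket_sum)

lemma q_bracket_add: "q_bracket (a + b) = q_bracket a + qvar ^ a * q_bracket b"
proof -
  have "(\<Sum>i<a + b. qvar ^ i) = (\<Sum>i<a. qvar ^ i) + (\<Sum>i<b. qvar ^ (a + i))"
    by (induction b) (simp_all add: algebra_simps)
  then show ?thesis
    by (simp only: q_bracket_sum sum_distrib_left power_add)
qed

lemma q_bracket_nonzero:
  assumes "m > 0"
  shows "q_bracket m \<noteq> 0"
proof
  assume "q_bracket m = 0"
  \<comment> \<open>At q = 0 the polynomial 1 - q^m takes the value 1.\<close>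
  then have "poly (1 - qvar ^ m) 0 = 0" using q_bracket_times[of m] by simp
  then show False using assms by (simp add: zero_power)
qed

text \<open>Weight of a path that starts at height \<open>h\<close>, summed over its labelings. A
  down step from height 0 contributes the factor \<open>q_bracket 0 = 0\<close>, so paths that leave
  the half-plane vanish and the truncated \<open>h - 1\<close> does no harm.\<close>

primrec height_gen_fun :: "step list \<Rightarrow> nat \<Rightarrow> int poly" where
  "height_gen_fun [] h = (if h = 0 then 1 else 0)"
| "height_gen_fun (s # d) h =
    (case s of Up \<Rightarrow> qvar ^ Suc h * height_gen_fun d (Suc h)
     | Down \<Rightarrow> q_bracket h * height_gen_fun d (h - 1))"

definition step_gen_fun :: "step \<Rightarrow> nat \<Rightarrow> int poly" where
  "step_gen_fun s k = (case s of Up \<Rightarrow> qvar ^ k | Down \<Rightarrow> q_bracket k)"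

lemma level_0 [simp]: "level d 0 = 0"
  by (simp add: level_def)

lemma level_Cons_Suc [simp]: "level (s # d) (Suc i) = step_rise s + level d i"
  by (simp add: level_def)

lemma all_le_Suc_iff: "(\<forall>i\<le>Suc n. P i) \<longleftrightarrow> P 0 \<and> (\<forall>i\<le>n. P (Suc i))"
  by (metis Suc_le_mono le0 not0_implies_Suc)

text \<open>Removing the first step shifts all later levels by its rise, and the starting height
  absorbs the shift.\<close>

lemma height_gen_fun_eq:
  "height_gen_fun d h =
    (if (\<forall>i\<le>length d. 0 \<le> int h + level d i) \<and> int h + level d (length d) = 0
     then \<Prod>i<length d. step_gen_fun (d ! i) (nat (max (int h + level d i) (int h + level d (i + 1))))
     else 0)"
proof (induction d arbitrary: h)
  case Nil
  then show ?case by simp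
next
  case (Cons s d)
  show ?case
  proof (cases s)
    case Up
    have h: "int h + (1 + c) = int (Suc h) + c" for c by simp
    have "nat (max (int h + level (s # d) 0) (int h + level (s # d) (0 + 1))) = Suc h"
      using Up by simp
    then show ?thesis
      unfolding Up
      by (simp only: height_gen_fun.simps step.case Cons.IH list.size all_le_Suc_iff level_Cons_Suc
          step_rise.simps h prod.lessThan_Suc_shift One_nat_def add_0_right add_Suc_right)
        (auto simp: step_gen_fun_def)
  next
    case Down
    show ?thesis
    proof (cases h)
      case 0
      then have "\<not> (\<forall>i\<le>length (s # d). 0 \<le> int h + level (s # d) i)"
        using Down by (auto simp: all_le_Suc_iff intro!: exI[of _ 0])
      then show ?thesis
        by (simp only: if_False simp_thms) (simp add: 0 Down)
    next
      case (Suc h')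
      have h: "int h + (-1 + c) = int h' + c" for c using Suc by simp
      have nat_Suc: "nat (1 + int h') = Suc h'" by simp
      show ?thesis
        unfolding Down
        by (simp only: height_gen_fun.simps step.case Cons.IH list.size all_le_Suc_iff level_Cons_Suc
            step_rise.simps h prod.lessThan_Suc_shift One_nat_def add_0_right add_Suc_right)
          (auto simp: step_gen_fun_def Suc nat_Suc)
    qed
  qed
qed

text \<open>Labels at different down steps are independent, so the sum over labelings factors. A
  down step of height k contributes the sum of q^(l-1) over l = 1..k, which is [k].\<close>

lemma path_gen_fun_eq: "path_gen_fun d = (\<Prod>i<length d. step_gen_fun (d ! i) (step_height d i))"
proof -
  let ?D = "{i. i < length d \<and> d ! i = Down}" and ?U = "{i. i < length d \<and> d ! i = Up}"
  have split: "prod f {..<length d} = prod f ?U * prod f ?D" for f :: "nat \<Rightarrow> int poly"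
  proof -
    have "{..<length d} = ?U \<union> ?D" using step.exhaust by auto
    moreover have "prod f (?U \<union> ?D) = prod f ?U * prod f ?D"
      by (rule prod.union_disjoint) auto
    ultimately show ?thesis by metis
  qed
  have "path_gen_fun d = (\<Sum>lab\<in>labelings d. (\<Prod>i\<in>?U. qvar ^ step_height d i) * (\<Prod>i\<in>?D. qvar ^ (lab i - 1)))"
    unfolding path_gen_fun_def path_weight_def power_sum split
    by (auto intro!: sum.cong arg_cong2[of _ _ _ _ "(*)"] prod.cong simp: step_weight_def)
  also have "\<dots> = (\<Prod>i\<in>?U. qvar ^ step_height d i) * (\<Sum>lab\<in>labelings d. \<Prod>i\<in>?D. qvar ^ (lab i - 1))"
    by (simp only: sum_distrib_left)
  also have "(\<Sum>lab\<in>labelings d. \<Prod>i\<in>?D. qvar ^ (lab i - 1)) =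
    (\<Prod>i\<in>?D. \<Sum>l\<in>{1..step_height d i}. qvar ^ (l - 1))"
    unfolding labelings_def by (rule prod_sum_PiE[symmetric]) auto
  also have "\<dots> = (\<Prod>i\<in>?D. q_bracket (step_height d i))"
    unfolding q_bracket_sum
    by (intro prod.cong refl sum.reindex_bij_witness[of _ Suc "\<lambda>l. l - 1"]) auto
  finally show ?thesis
    unfolding split by (simp add: step_gen_fun_def)
qed

definition height_sum :: "nat \<Rightarrow> nat \<Rightarrow> int poly" where
  "height_sum m h = (\<Sum>d | length d = m. height_gen_fun d h)"

lemma finite_step_lists: "finite {d :: step list. length d = m}"
proof (rule finite_subset)
  show "{d. length d = m} \<subseteq> {d. set d \<subseteq> {Up, Down} \<and> length d = m}"
    using step.exhaust by auto
qed (rule finite_lists_length_eq, simp)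

lemma height_sum_0: "height_sum 0 h = (if h = 0 then 1 else 0)"
  by (simp add: height_sum_def)

lemma height_sum_Suc:
  "height_sum (Suc m) h = qvar ^ Suc h * height_sum m (Suc h) + q_bracket h * height_sum m (h - 1)"
proof -
  let ?L = "{d :: step list. length d = m}"
  have "{d :: step list. length d = Suc m} = (#) Up ` ?L \<union> (#) Down ` ?L"
    using step.exhaust by (auto simp: length_Suc_conv image_iff)
  moreover have "(\<Sum>d\<in>(#) Up ` ?L \<union> (#) Down ` ?L. height_gen_fun d h) =
    (\<Sum>d\<in>(#) Up ` ?L. height_gen_fun d h) + (\<Sum>d\<in>(#) Down ` ?L. height_gen_fun d h)"
    by (rule sum.union_disjoint) (use finite_step_lists in auto)
  ultimately have "height_sum (Suc m) h =
    (\<Sum>d\<in>(#) Up ` ?L. height_gen_fun d h) + (\<Sum>d\<in>(#) Down ` ?L. height_gen_fun d h)"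
    unfolding height_sum_def by metis
  then show ?thesis
    by (simp add: sum.reindex height_sum_def sum_distrib_left)
qed

text \<open>At least \<open>h\<close> steps are needed to come down from height
  \<open>h\<close>.\<close>

lemma height_sum_eq_0: "m < h \<Longrightarrow> height_sum m h = 0"
  by (induction m arbitrary: h) (simp_all add: height_sum_0 height_sum_Suc)

lemma sum_dyck_paths: "(\<Sum>d\<in>dyck_paths m. path_gen_fun d) = height_sum m 0"
proof -
  have "(\<Sum>d\<in>dyck_paths m. path_gen_fun d) = (\<Sum>d\<in>dyck_paths m. height_gen_fun d 0)"
    by (intro sum.cong) (auto simp: dyck_paths_def height_gen_fun_eq path_gen_fun_eq step_height_def)
  also have "\<dots> = height_sum m 0"
    unfolding height_sum_def
    by (intro sum.mono_neutral_left finite_step_lists) (auto simp: dyck_paths_def height_gen_fun_eq)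
  finally show ?thesis .
qed

text \<open>The division by [2][4]...[2k] is cleared. In the induction on the path length an up step
  leads to (h + 1, k - 1) and a down step to (h - 1, k).\<close>

lemma height_sum_closed_form:
  "(\<Prod>i = 1..k. q_bracket (2 * i)) * height_sum (h + 2 * k) h =
    qvar ^ k * (\<Prod>i = 1..h + 2 * k. q_bracket i)"
proof (induction "h + 2 * k" arbitrary: h k)
  case 0
  then show ?case by (simp add: height_sum_0)
next
  case (Suc m)
  let ?E = "\<lambda>k. \<Prod>i = 1..k. q_bracket (2 * i)" and ?F = "\<lambda>m. \<Prod>i = 1..m. q_bracket i"
  \<comment> \<open>For \<open>k = 0\<close> both sides vanish: no path of length m comes down from
    height h + 1, and [0] = 0.\<close>
  have up: "?E k * height_sum m (Suc h) * qvar ^ Suc h = qvar ^ h * q_bracket (2 * k) * (qvar ^ k * ?F m)"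
  proof (cases k)
    case 0
    then show ?thesis using Suc.hyps(2) by (simp add: height_sum_eq_0)
  next
    case (Suc k')
    have m: "m = Suc h + 2 * k'" using Suc Suc.hyps(2) by simp
    have "?E k * height_sum m (Suc h) = q_bracket (2 * k) * (qvar ^ k' * ?F m)"
      using Suc.hyps(1)[OF m] unfolding Suc m[symmetric]
      by (simp add: prod.nat_ivl_Suc' mult_ac)
    then show ?thesis by (simp add: Suc mult_ac)
  qed
  \<comment> \<open>The factor [h] is kept on both sides so that the equation also holds for
    \<open>h = 0\<close>.\<close>
  have down: "q_bracket h * (?E k * height_sum m (h - 1)) = q_bracket h * (qvar ^ k * ?F m)"
  proof (cases h)
    case (Suc h')
    then have "m = h' + 2 * k" using Suc.hyps(2) by simp
    then show ?thesis using Suc.hyps(1)[of h' k] Suc by simp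
  qed simp
  have "?E k * height_sum (h + 2 * k) h =
    ?E k * height_sum m (Suc h) * qvar ^ Suc h + q_bracket h * (?E k * height_sum m (h - 1))"
    unfolding Suc.hyps(2)[symmetric] height_sum_Suc by (simp add: algebra_simps)
  also have "\<dots> = (q_bracket h + qvar ^ h * q_bracket (2 * k)) * (qvar ^ k * ?F m)"
    unfolding up down by (simp only: distrib_right add.commute)
  also have "\<dots> = qvar ^ k * (q_bracket (h + 2 * k) * ?F m)"
    by (simp only: q_bracket_add mult_ac)
  also have "q_bracket (h + 2 * k) * ?F m = ?F (h + 2 * k)"
    unfolding Suc.hyps(2)[symmetric] by (simp add: mult.commute)
  finally show ?case .
qed

lemma prod_even_odd:
  fixes f :: "nat \<Rightarrow> 'a :: comm_monoid_mult" and n :: nat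
  shows "(\<Prod>i = 1..2 * n. f i) = (\<Prod>i = 1..n. f (2 * i)) * (\<Prod>i = 1..n. f (2 * i - 1))"
  by (induction n) (simp_all add: mult_ac)

text \<open>For h = 0 the nonzero even factors of [2n]! cancel and the odd ones remain.\<close>

lemma sum_dyck_paths_eq:
  "(\<Sum>d\<in>dyck_paths (2 * n). path_gen_fun d) = qvar ^ n * (\<Prod>k = 1..n. q_bracket (2 * k - 1))"
proof -
  let ?E = "\<Prod>i = 1..n. q_bracket (2 * i)"
  have "?E * height_sum (2 * n) 0 = ?E * (qvar ^ n * (\<Prod>k = 1..n. q_bracket (2 * k - 1)))"
    using height_sum_closed_form[of n 0]
    by (simp only: add_0 prod_even_odd[of q_bracket n] mult.left_commute[of "qvar ^ n"])
  moreover have "?E \<noteq> 0"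
    using q_bracket_nonzero by (auto simp: prod_zero_iff)
  ultimately show ?thesis
    unfolding sum_dyck_paths by (metis mult_cancel_left)
qed

subsection \<open>The rank generating function\<close>

text \<open>If 2n is paired with a + 1, then a + 1 carries the largest value, so there is an ascent
  at \<open>a\<close>. Conjugation raises the rank by 1 and, as the swap fixes 2n, makes
  \<open>a\<close> its partner.\<close>

lemma sum_fpf_rank_adj_conj:
  assumes a: "1 \<le> a" "Suc a < 2 * n"
  shows "(\<Sum>t | t \<in> fpf_involutions (2 * n) \<and> t (2 * n) = a. qvar ^ fpf_rank n t) =
    qvar * (\<Sum>t | t \<in> fpf_involutions (2 * n) \<and> t (2 * n) = Suc a. qvar ^ fpf_rank n t)"
proof -
  let ?S = "\<lambda>a. {t. t \<in> fpf_involutions (2 * n) \<and> t (2 * n) = a}"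
  have k: "1 \<le> a" "a < 2 * n" using a by auto
  have rank: "fpf_rank n (adj_conj a t) = fpf_rank n t + 1" if "t \<in> ?S (Suc a)" for t
  proof -
    have t: "t \<in> fpf_involutions (2 * n)" and "t (2 * n) = Suc a" using that by auto
    then have "t (Suc a) = 2 * n" using fpf_invol by metis
    moreover have "t a \<le> 2 * n" using fpf_range[OF t] a by auto
    moreover have "t a \<noteq> t (Suc a)" using fpf_eq_iff[OF t] by simp
    ultimately have "t a < t (Suc a)" by simp
    from adj_conj_ascent(1)[OF t k this] show ?thesis by (rule fpf_rank_Suc[OF t])
  qed
  have "(\<Sum>t\<in>?S a. qvar ^ fpf_rank n t) = (\<Sum>t\<in>?S (Suc a). qvar ^ fpf_rank n (adj_conj a t))"
    by (rule sum.reindex_bij_witness[of _ "adj_conj a" "adj_conj a"])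
      (use a adj_conj_fpf[OF _ k] in \<open>auto simp: adj_conj_idem\<close>)
  also have "\<dots> = qvar * (\<Sum>t\<in>?S (Suc a). qvar ^ fpf_rank n t)"
    unfolding sum_distrib_left by (intro sum.cong refl) (simp only: rank power_add power_one_right mult.commute)
  finally show ?thesis .
qed

text \<open>The added points are fixed and lie above all others, so they take part in no
  inversion.\<close>

lemma perm_length_mono_support:
  assumes t: "t permutes {1..m}" and le: "m \<le> m'"
  shows "perm_length m' t = perm_length m t"
proof -
  have out: "t v = v" if "v \<notin> {1..m}" for v using t that by (simp add: permutes_def)
  have rng: "t v \<le> m" if "v \<le> m" for v
    using permutes_in_image[OF t, of v] out[of v] that by (cases "v = 0") auto
  have "{(i, j). i \<in> {1..m'} \<and> j \<in> {1..m'} \<and> i < j \<and> t i > t j} =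
    {(i, j). i \<in> {1..m} \<and> j \<in> {1..m} \<and> i < j \<and> t i > t j}"
  proof (rule set_eqI, clarify)
    fix i j
    show "(i, j) \<in> {(i, j). i \<in> {1..m'} \<and> j \<in> {1..m'} \<and> i < j \<and> t i > t j} \<longleftrightarrow>
      (i, j) \<in> {(i, j). i \<in> {1..m} \<and> j \<in> {1..m} \<and> i < j \<and> t i > t j}"
      using out[of j] out[of i] rng[of i] le by (cases "j \<le> m"; cases "i \<le> m") auto
  qed
  then show ?thesis by (simp add: perm_length_def)
qed

text \<open>Multiplication by s deletes or adds the 2-cycle (2n+1 2n+2). This changes both the
  length and the number of 2-cycles by 1, so the rank stays the same.\<close>

lemma sum_fpf_rank_last:
  "(\<Sum>t | t \<in> fpf_involutions (2 * Suc n) \<and> t (2 * Suc n) = 2 * n + 1. qvar ^ fpf_rank (Suc n) t) =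
    (\<Sum>t\<in>fpf_involutions (2 * n). qvar ^ fpf_rank n t)"
proof -
  let ?k = "2 * n + 1" and ?m = "2 * Suc n"
  let ?s = "adj_swap ?k"
  have k: "1 \<le> ?k" "?k < ?m" by auto
  have ext: "?s \<circ> t \<in> fpf_involutions ?m \<and> (?s \<circ> t) ?m = ?k \<and>
      fpf_rank (Suc n) (?s \<circ> t) = fpf_rank n t"
    if t: "t \<in> fpf_involutions (2 * n)" for t
  proof -
    have p: "t permutes {1..2 * n}" by (rule fpf_permutes[OF t])
    then have pm: "t permutes {1..?m}" by (rule permutes_subset) auto
    have out: "t v = v" if "v > 2 * n" for v using p that by (auto simp: permutes_def)
    have rng: "t v \<le> 2 * n" if "v \<le> 2 * n" for v
      using fpf_range(2)[OF t, of v] that p by (cases "v = 0") (auto simp: permutes_def)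
    \<comment> \<open>The product acts as \<open>t\<close> up to 2n and as the swap beyond.\<close>
    have sv: "?s (t v) = (if v \<le> 2 * n then t v else ?s v)" for v
      using out[of v] rng[of v] by (auto simp: transpose_def)
    have "?s \<circ> t \<in> fpf_involutions ?m"
      unfolding fpf_involutions_def
    proof (intro CollectI conjI ballI)
      show "?s \<circ> t permutes {1..?m}" by (rule adj_swap_comp_permutes[OF pm k])
      show "?s \<circ> t \<circ> (?s \<circ> t) = id"
      proof
        fix v
        show "(?s \<circ> t \<circ> (?s \<circ> t)) v = id v"
        proof (cases "v \<le> 2 * n")
          case True
          then show ?thesis using sv[of v] sv[of "t v"] rng[of v] t by simp
        next
          case False
          then have "?s v > 2 * n" by (auto simp: transpose_def)
          then show ?thesis using False sv[of v] sv[of "?s v"] by simp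
        qed
      qed
      fix i assume "i \<in> {1..?m}"
      then show "(?s \<circ> t) i \<noteq> i"
        using sv[of i] fpf_neq[OF t, of i] by (auto simp: transpose_def)
    qed
    moreover have "(?s \<circ> t) ?m = ?k" using out[of ?m] by simp
    moreover have "inv t ?k < inv t (Suc ?k)" using out by (simp add: fpf_inv[OF t])
    then have "perm_length ?m (?s \<circ> t) = perm_length (2 * n) t + 1"
      using perm_length_adj_swap[OF pm k] perm_length_mono_support[OF p, of ?m] by simp
    ultimately show ?thesis by (simp only: fpf_rank_def) simp
  qed
  have restr: "?s \<circ> t \<in> fpf_involutions (2 * n)"
    if t: "t \<in> fpf_involutions ?m" and tm: "t ?m = ?k" for t
  proof -
    have tk: "t ?k = ?m" using tm t by (metis fpf_invol)
    have p: "?s \<circ> t permutes {1..?m}" by (rule adj_swap_comp_permutes[OF fpf_permutes[OF t] k])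
    have fix1: "(?s \<circ> t) ?k = ?k" "(?s \<circ> t) ?m = ?m" using tk tm by simp_all
    have low: "t v \<noteq> ?k" "t v \<noteq> ?m" if "v \<le> 2 * n" for v
      using that tk tm fpf_eq_iff[OF t, of v ?m] fpf_eq_iff[OF t, of v ?k] by auto
    have sv: "?s (t v) = t v" if "v \<le> 2 * n" for v
      using low[OF that] by simp
    have p': "?s \<circ> t permutes {1..2 * n}"
    proof (rule permutes_superset[OF p])
      fix v assume "v \<in> {1..?m} - {1..2 * n}"
      then have "v = ?k \<or> v = ?m" by auto
      then show "(?s \<circ> t) v = v" using fix1 by metis
    qed
    show ?thesis
      unfolding fpf_involutions_def
    proof (intro CollectI conjI ballI)
      show "?s \<circ> t permutes {1..2 * n}" by (rule p')
      show "?s \<circ> t \<circ> (?s \<circ> t) = id"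
        using fpf_comp_adj_swap_commute[OF t, of ?k] tk t
        by (simp add: fun_eq_iff)
      fix i assume i: "i \<in> {1..2 * n}"
      then show "(?s \<circ> t) i \<noteq> i" using sv[of i] fpf_neq[OF t, of i] by auto
    qed
  qed
  have rank: "fpf_rank n (?s \<circ> t) = fpf_rank (Suc n) t"
    if "t \<in> fpf_involutions ?m" "t ?m = ?k" for t
    using ext[OF restr[OF that]] by (simp only: adj_swap_comp_idem)
  show ?thesis
    by (rule sum.reindex_bij_witness[of _ "\<lambda>t. ?s \<circ> t" "\<lambda>t. ?s \<circ> t"])
      (use ext restr rank in \<open>auto simp only: adj_swap_comp_idem mem_Collect_eq\<close>)
qed

lemma sum_fpf_rank:
  "(\<Sum>t\<in>fpf_involutions (2 * n). qvar ^ fpf_rank n t) = (\<Prod>k = 1..n. q_bracket (2 * k - 1))"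
proof (induction n)
  case 0
  have "fpf_involutions (2 * 0) = {id}"
    by (auto simp: fpf_involutions_def)
  then show ?case by (simp add: fpf_rank_def perm_length_def)
next
  case (Suc n)
  let ?m = "2 * Suc n"
  let ?P = "fpf_involutions ?m"
  let ?f = "\<lambda>t. qvar ^ fpf_rank (Suc n) t"
  let ?S = "\<lambda>a. \<Sum>t | t \<in> ?P \<and> t ?m = a. ?f t"
  let ?B = "\<Sum>t\<in>fpf_involutions (2 * n). qvar ^ fpf_rank n t"
  \<comment> \<open>Here \<open>j\<close> counts the conjugations that lead down from the class 2n +
    1, each contributing a factor q.\<close>
  have S: "?S (2 * n + 1 - j) = qvar ^ j * ?B" if "j \<le> 2 * n" for j
    using that
  proof (induction j)
    case 0
    then show ?case using sum_fpf_rank_last[of n] by simp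
  next
    case (Suc j)
    have a: "1 \<le> 2 * n + 1 - Suc j" "Suc (2 * n + 1 - Suc j) < ?m"
      and eq: "Suc (2 * n + 1 - Suc j) = 2 * n + 1 - j"
      using Suc.prems by auto
    have "?S (2 * n + 1 - Suc j) = qvar * ?S (2 * n + 1 - j)"
      using sum_fpf_rank_adj_conj[OF a] unfolding eq .
    also have "\<dots> = qvar * (qvar ^ j * ?B)" using Suc by simp
    finally show ?case by (simp only: power_Suc mult.assoc)
  qed
  \<comment> \<open>The last point is not fixed, so its partner is at most 2n + 1; the sum is
    grouped by this partner.\<close>
  have "t ?m \<in> {1..2 * n + 1}" if t: "t \<in> ?P" for t
    using fpf_range[OF t, of ?m] fpf_neq[OF t, of ?m] by auto
  then have "(\<Sum>t\<in>?P. ?f t) = (\<Sum>a\<in>{1..2 * n + 1}. ?S a)"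
    by (intro sum.group[symmetric] finite_fpf_involutions) auto
  also have "\<dots> = (\<Sum>j<2 * n + 1. ?S (2 * n + 1 - j))"
    by (rule sum.reindex_bij_witness[of _ "\<lambda>j. 2 * n + 1 - j" "\<lambda>a. 2 * n + 1 - a"]) auto
  also have "\<dots> = (\<Sum>j<2 * n + 1. qvar ^ j * ?B)"
    by (intro sum.cong refl S) auto
  also have "\<dots> = q_bracket (2 * n + 1) * ?B"
    by (simp only: q_bracket_sum sum_distrib_right)
  also have "\<dots> = (\<Prod>k = 1..Suc n. q_bracket (2 * k - 1))"
    unfolding Suc.IH by (simp add: mult.commute)
  finally show ?case .
qed

theorem corollary1p2:
  fixes n :: nat
  shows "(\<Sum>d\<in>dyck_paths (2 * n). path_gen_fun d) =
           qvar ^ n * rank_gen_fun (fpf_involutions (2 * n)) (bruhat_le (2 * n)) \<and>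
         qvar ^ n * rank_gen_fun (fpf_involutions (2 * n)) (bruhat_le (2 * n)) =
           qvar ^ n * (\<Prod>k = 1..n. q_bracket (2 * k - 1))"
proof -
  have "rank_gen_fun (fpf_involutions (2 * n)) (bruhat_le (2 * n)) = (\<Prod>k = 1..n. q_bracket (2 * k - 1))"
    unfolding rank_gen_fun_def sum_fpf_rank[symmetric]
    by (intro sum.cong refl) (simp only: poset_rank_fpf)
  then show ?thesis using sum_dyck_paths_eq[of n] by simp
qed

end
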